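(* Let $n\ge 2$, $0\le m\le n$, and let $P=(p_{jk})$ be a real $n\times n$-matrix. The problem $$\partial_t u_j + a_j(x,t)\partial_x u_j + b_j(x,t)u_j = 0,\quad 0<x<1,\ t>0,\ j\le n,$$ $$u_j(0,t) = \sum_{k=1}^m p_{jk}u_k(1,t)+\sum_{k=m+1}^n p_{jk}u_k(0,t),\quad t\ge 0,\ 1\le j\le m,$$ $$u_j(1,t) = \sum_{k=1}^m p_{jk}u_k(1,t)+\sum_{k=m+1}^n p_{jk}u_k(0,t),\quad t\ge 0,\ m<j\le n,$$ $$u_j(x,0)=\varphi_j(x),\quad 0\le x\le 1,\ j\le n,$$ is robust FTS if and only if the directed graph $G_P$ is acyclic.
   Context: Let $\Pi=\{(x,t): 0\le x\le 1,\ 0\le t<\infty\}$. All functions are real-valued; $L^2(0,1)^n$ is normed by $\|u\|=\max_{j\le n}\|u_j\|_{L^2(0,1)}$. Admissible coefficients: (i) there is $a>0$ with $a_j\ge a$ on $\Pi$ for $1\le j\le m$ and $a_j\le -a$ on $\Pi$ for $m+1\le j\le n$; (ii) $a_j,b_j\in C^1(\Pi)$ are bounded in $\Pi$ together with their first order derivatives. $C_0^\infty([0,1])$ is the space of functions in $C^\infty([0,1])$ with support within $(0,1)$. For admissible coefficients and $\varphi\in C_0^\infty([0,1])^n$ the problem has a unique classical $C^1$-solution in $\Pi$. For $\varphi\in L^2(0,1)^n$, a function $u\in C([0,\infty),L^2(0,1))^n$ is an $L^2$-generalized solution if for any sequence $\varphi^l\in C_0^\infty([0,1])^n$ with $\varphi^l\to\varphi$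 in $L^2(0,1)^n$, the classical $C^1$-solutions $u^l$ with initial data $\varphi^l$ satisfy $\|u(\cdot,t)-u^l(\cdot,t)\|_{L^2(0,1)^n}\to 0$ as $l\to\infty$, uniformly in $t\in[0,T]$ for each $T>0$. For every $\varphi\in L^2(0,1)^n$ there is a unique $L^2$-generalized solution. The problem is finite time stabilizable (FTS) if there exists $T_e>0$ such that for every $\varphi\in L^2(0,1)^n$ the $L^2$-generalized solution is zero for all $t>T_e$. It is robust FTS if it is FTS for any admissible coefficients $a_j,b_j$ (with $m$ and $P$ fixed). $G_P$ is the directed graph on vertex set $\{1,\dots,n\}$ with an arrow $(j,k)$ if and only if $p_{jk}\ne 0$. A cycle of length $l\ge 1$ in a directed graph with arrow set $E$ is a sequence of pairwise distinct vertices $(k_1,\dots,k_l)$ such that $(k_s,k_{s+1})\in E$ for all $s<l$ and $(k_l,k_1)\in E$ (so a loop is a cycle of length 1). A directed graph is acyclic if it has no cycles. *)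

theory Defs
  imports "HOL-Analysis.Analysis"
begin

text \<open>
  Component indices range over \<open>{1..n}\<close> and are natural numbers; values of vector-valued objects and
  of \<open>p\<close> at other indices are irrelevant. A point \<open>(x, t)\<close> of the half-strip is a pair of reals.
\<close>

definition Pi_strip :: "(real \<times> real) set" where
  "Pi_strip = {0..1} \<times> {0..}"

text \<open>
  \<open>f\<close> is \<open>C\<^sup>1\<close> on the closed half-strip with partial derivatives \<open>fx\<close> and \<open>ft\<close>. At boundary points the
  derivative is taken within the half-strip, so it is one-sided there. The half-strip is convex with
  nonempty interior, hence \<open>fx\<close> and \<open>ft\<close> are uniquely determined on it.
\<close>

definition C1_with_partials ::
  "(real \<times> real \<Rightarrow> real) \<Rightarrow> (real \<times> real \<Rightarrow> real) \<Rightarrow> (real \<times> real \<Rightarrow> real) \<Rightarrow> bool" where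
  "C1_with_partials f fx ft \<longleftrightarrow>
     continuous_on Pi_strip fx \<and> continuous_on Pi_strip ft \<and>
     (\<forall>z\<in>Pi_strip. (f has_derivative (\<lambda>(h, k). fx z * h + ft z * k)) (at z within Pi_strip))"

definition C1_Pi :: "(real \<times> real \<Rightarrow> real) \<Rightarrow> bool" where
  "C1_Pi f \<longleftrightarrow> (\<exists>fx ft. C1_with_partials f fx ft)"

definition bounded_C1_Pi :: "(real \<times> real \<Rightarrow> real) \<Rightarrow> bool" where
  "bounded_C1_Pi f \<longleftrightarrow>
     (\<exists>fx ft. C1_with_partials f fx ft \<and>
        bounded (f ` Pi_strip) \<and> bounded (fx ` Pi_strip) \<and> bounded (ft ` Pi_strip))"

definition admissible ::
  "nat \<Rightarrow> nat \<Rightarrow> (nat \<Rightarrow> real \<times> real \<Rightarrow> real) \<Rightarrow> (nat \<Rightarrow> real \<times> real \<Rightarrow> real) \<Rightarrow> bool" where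
  "admissible n m a b \<longleftrightarrow>
     (\<exists>a0>0. (\<forall>j\<in>{1..m}. \<forall>z\<in>Pi_strip. a j z \<ge> a0) \<and>
             (\<forall>j\<in>{m+1..n}. \<forall>z\<in>Pi_strip. a j z \<le> - a0)) \<and>
     (\<forall>j\<in>{1..n}. bounded_C1_Pi (a j) \<and> bounded_C1_Pi (b j))"

text \<open>
  Elements of \<open>L\<^sup>2(0,1)\<close> are represented by functions; equality in \<open>L\<^sup>2(0,1)\<close> is equality almost
  everywhere on the open unit interval.
\<close>

definition in_L2 :: "(real \<Rightarrow> real) \<Rightarrow> bool" where
  "in_L2 f \<longleftrightarrow> f \<in> borel_measurable (lebesgue_on {0<..<1}) \<and>
     integrable (lebesgue_on {0<..<1}) (\<lambda>x. (f x)\<^sup>2)"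

definition norm_L2 :: "(real \<Rightarrow> real) \<Rightarrow> real" where
  "norm_L2 f = sqrt (\<integral>x. (f x)\<^sup>2 \<partial>lebesgue_on {0<..<1})"

definition norm_L2n :: "nat \<Rightarrow> (nat \<Rightarrow> real \<Rightarrow> real) \<Rightarrow> real" where
  "norm_L2n n f = Max ((\<lambda>j. norm_L2 (f j)) ` {1..n})"

text \<open>
  Below, \<open>D k\<close> is the \<open>k\<close>-th derivative on \<open>[0,1]\<close> (one-sided at the endpoints).
\<close>

definition C0_inf :: "(real \<Rightarrow> real) \<Rightarrow> bool" where
  "C0_inf f \<longleftrightarrow>
     (\<exists>D :: nat \<Rightarrow> real \<Rightarrow> real.
        (\<forall>x\<in>{0..1}. D 0 x = f x) \<and>
        (\<forall>k. \<forall>x\<in>{0..1}. (D k has_real_derivative D (Suc k) x) (at x within {0..1}))) \<and>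
     closure (support_on {0..1} f) \<subseteq> {0<..<1}"

definition boundary_value ::
  "nat \<Rightarrow> nat \<Rightarrow> (nat \<Rightarrow> nat \<Rightarrow> real) \<Rightarrow> (nat \<Rightarrow> real \<times> real \<Rightarrow> real) \<Rightarrow> nat \<Rightarrow> real \<Rightarrow> real" where
  "boundary_value n m p u j t =
     (\<Sum>k=1..m. p j k * u k (1, t)) + (\<Sum>k=m+1..n. p j k * u k (0, t))"

definition classical_solution ::
  "nat \<Rightarrow> nat \<Rightarrow> (nat \<Rightarrow> nat \<Rightarrow> real) \<Rightarrow> (nat \<Rightarrow> real \<times> real \<Rightarrow> real) \<Rightarrow> (nat \<Rightarrow> real \<times> real \<Rightarrow> real) \<Rightarrow>
   (nat \<Rightarrow> real \<Rightarrow> real) \<Rightarrow> (nat \<Rightarrow> real \<times> real \<Rightarrow> real) \<Rightarrow> bool" where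
  "classical_solution n m p a b \<phi> u \<longleftrightarrow>
     (\<forall>j\<in>{1..n}. C1_Pi (u j)) \<and>
     (\<forall>j\<in>{1..n}. \<forall>x t. 0 < x \<and> x < 1 \<and> 0 < t \<longrightarrow>
        deriv (\<lambda>s. u j (x, s)) t + a j (x, t) * deriv (\<lambda>y. u j (y, t)) x
          + b j (x, t) * u j (x, t) = 0) \<and>
     (\<forall>j\<in>{1..m}. \<forall>t\<ge>0. u j (0, t) = boundary_value n m p u j t) \<and>
     (\<forall>j\<in>{m+1..n}. \<forall>t\<ge>0. u j (1, t) = boundary_value n m p u j t) \<and>
     (\<forall>j\<in>{1..n}. \<forall>x\<in>{0..1}. u j (x, 0) = \<phi> j x)"

text \<open>
  Here \<open>u j t\<close> is the \<open>j\<close>-th component at time \<open>t\<close>, as a (representative of an) element of \<open>L\<^sup>2(0,1)\<close>.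
  The classical solutions \<open>U l\<close> are quantified universally; each of them exists and is unique on the
  half-strip when the coefficients are admissible.
\<close>

definition L2_generalized_solution ::
  "nat \<Rightarrow> nat \<Rightarrow> (nat \<Rightarrow> nat \<Rightarrow> real) \<Rightarrow> (nat \<Rightarrow> real \<times> real \<Rightarrow> real) \<Rightarrow> (nat \<Rightarrow> real \<times> real \<Rightarrow> real) \<Rightarrow>
   (nat \<Rightarrow> real \<Rightarrow> real) \<Rightarrow> (nat \<Rightarrow> real \<Rightarrow> real \<Rightarrow> real) \<Rightarrow> bool" where
  "L2_generalized_solution n m p a b \<phi> u \<longleftrightarrow>
     (\<forall>j\<in>{1..n}. \<forall>t\<ge>0. in_L2 (u j t)) \<and>
     (\<forall>j\<in>{1..n}. \<forall>t\<ge>0. ((\<lambda>s. norm_L2 (\<lambda>x. u j s x - u j t x)) \<longlongrightarrow> 0) (at t within {0..})) \<and>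
     (\<forall>(\<phi>l :: nat \<Rightarrow> nat \<Rightarrow> real \<Rightarrow> real) (U :: nat \<Rightarrow> nat \<Rightarrow> real \<times> real \<Rightarrow> real).
        (\<forall>l. \<forall>j\<in>{1..n}. C0_inf (\<phi>l l j)) \<and>
        (\<lambda>l. norm_L2n n (\<lambda>j x. \<phi>l l j x - \<phi> j x)) \<longlonglongrightarrow> 0 \<and>
        (\<forall>l. classical_solution n m p a b (\<phi>l l) (U l)) \<longrightarrow>
        (\<forall>T>0. uniform_limit {0..T}
           (\<lambda>l t. norm_L2n n (\<lambda>j x. u j t x - U l j (x, t))) (\<lambda>t. 0) sequentially))"

text \<open>
  Finite time stabilizability. For admissible coefficients the generalized solution exists and is
  unique (almost everywhere, for each time), so the existential quantifier over \<open>u\<close> picks out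
  the generalized solution.
\<close>

definition FTS ::
  "nat \<Rightarrow> nat \<Rightarrow> (nat \<Rightarrow> nat \<Rightarrow> real) \<Rightarrow> (nat \<Rightarrow> real \<times> real \<Rightarrow> real) \<Rightarrow> (nat \<Rightarrow> real \<times> real \<Rightarrow> real) \<Rightarrow> bool" where
  "FTS n m p a b \<longleftrightarrow>
     (\<exists>Te>0. \<forall>\<phi>. (\<forall>j\<in>{1..n}. in_L2 (\<phi> j)) \<longrightarrow>
        (\<exists>u. L2_generalized_solution n m p a b \<phi> u \<and>
           (\<forall>t>Te. \<forall>j\<in>{1..n}. AE x in lebesgue_on {0<..<1}. u j t x = 0)))"

definition robust_FTS :: "nat \<Rightarrow> nat \<Rightarrow> (nat \<Rightarrow> nat \<Rightarrow> real) \<Rightarrow> bool" where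
  "robust_FTS n m p \<longleftrightarrow> (\<forall>a b. admissible n m a b \<longrightarrow> FTS n m p a b)"

definition G_arrows :: "nat \<Rightarrow> (nat \<Rightarrow> nat \<Rightarrow> real) \<Rightarrow> (nat \<times> nat) set" where
  "G_arrows n p = {(j, k). j \<in> {1..n} \<and> k \<in> {1..n} \<and> p j k \<noteq> 0}"

definition is_cycle :: "'v set \<Rightarrow> ('v \<times> 'v) set \<Rightarrow> 'v list \<Rightarrow> bool" where
  "is_cycle V E ks \<longleftrightarrow>
     ks \<noteq> [] \<and> set ks \<subseteq> V \<and> distinct ks \<and>
     (\<forall>s. Suc s < length ks \<longrightarrow> (ks ! s, ks ! Suc s) \<in> E) \<and>
     (last ks, hd ks) \<in> E"

definition acyclic_digraph :: "'v set \<Rightarrow> ('v \<times> 'v) set \<Rightarrow> bool" where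
  "acyclic_digraph V E \<longleftrightarrow> (\<nexists>ks. is_cycle V E ks)"

end

theory Submission
  imports Defs
begin

text \<open>
  Suppose first that the graph is acyclic. A component whose vertex has no outgoing arrows receives
  nothing at its inflow end, so after the time needed to cross the interval at the minimal speed
  \<open>a0\<close> it is gone. From then on the arrows pointing to it carry nothing, so the same
  applies to the next component, until all have died; the total waiting time does not depend on the
  solution (lemma \<open>acyclic_extinction\<close>). This reasoning is usually done along
  characteristics. Here it is done by energy estimates with weights \<open>exp (k + c * x)\<close>
  (lemma \<open>energy_derivative\<close>): a weight that falls by the factor \<open>exp l\<close> from the inflow to the
  outflow end yields, up to a constant, the decay rate \<open>l * a0\<close> at the price of a factor
  \<open>exp l\<close>. Letting \<open>l\<close> tend to infinity forces the solution to vanish after time \<open>1 / a0\<close>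
  (lemma \<open>zero_inflow_extinction\<close>). A weight growing towards the outflow ends makes the
  outflow term absorb the reflected inflow, which gives stability in \<open>L\<^sup>2\<close> for every matrix
  (lemma \<open>classical_stability\<close>). Stability and completeness of \<open>L\<^sup>2\<close> turn any
  sequence of classical solutions with converging data into a generalized solution, which inherits
  extinction (lemma \<open>generalized_solution_exists\<close>). If there is no such sequence, the
  condition on a generalized solution holds vacuously for the zero function.

  Now suppose that there is a cycle. Take all speeds equal to \<open>1\<close> or \<open>-1\<close> and constant
  \<open>b j = - ln (d j)\<close>, so that component \<open>j\<close> is multiplied by \<open>d j\<close> while crossing the
  interval. The inflow amplitudes at time \<open>t\<close> are then those at time \<open>t - 1\<close> multiplied by
  the matrix \<open>p\<close> times the diagonal matrix of \<open>d\<close>, and an explicit train of bumps with these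
  amplitudes is a classical solution (lemma \<open>pulse_solution_classical\<close>). It remains to choose
  \<open>d\<close> so that the powers of this matrix never kill some vector. On the vertices of a
  chordless cycle the matrix \<open>p\<close> is a weighted cyclic permutation, hence invertible; with
  \<open>d = 1\<close> there and \<open>d\<close> tiny elsewhere, the other components are a small
  perturbation, and a cone of vectors dominated by their entries on the cycle is invariant
  (lemma \<open>persistent_amplitude\<close>). The generalized solution with the corresponding smooth data
  coincides with the bump train, which lives forever.
\<close>

section \<open>Directed graphs without cycles\<close>

text \<open>
  Following outgoing arrows inside a finite set must revisit a vertex. The first return closes a
  walk that had no repetition before.
\<close>

lemma cycle_of_outgoing_arrows:
  assumes "finite S" "S \<noteq> {}" "S \<subseteq> V"
    and out: "\<And>i. i \<in> S \<Longrightarrow> \<exists>j\<in>S. (i, j) \<in> E"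
  shows "\<exists>ks. is_cycle V E ks"
proof -
  obtain f where f: "\<And>i. i \<in> S \<Longrightarrow> f i \<in> S \<and> (i, f i) \<in> E"
    using out by metis
  obtain x where x: "x \<in> S" using \<open>S \<noteq> {}\<close> by blast
  define g where "g s = (f ^^ s) x" for s
  have gS: "g s \<in> S" for s
    by (induction s) (auto simp: g_def x f)
  have gE: "(g s, g (Suc s)) \<in> E" for s
    using f[OF gS[of s]] by (simp add: g_def)
  have "\<not> inj g"
    using finite_subset[of "range g" S] \<open>finite S\<close> gS finite_imageD[of g UNIV] by auto
  then obtain r s where "r \<noteq> s" "g r = g s" unfolding inj_def by blast
  then have ex: "\<exists>j. \<exists>i<j. g i = g j"
    by (metis linorder_neqE_nat)
  define j where "j = (LEAST j. \<exists>i<j. g i = g j)"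
  obtain i where i: "i < j" "g i = g j"
    using LeastI_ex[OF ex] unfolding j_def by blast
  have inj: "inj_on g {..<j}"
  proof (rule linorder_inj_onI)
    fix r s assume "r < s" "r \<in> {..<j}" "s \<in> {..<j}"
    then show "g r \<noteq> g s"
      using not_less_Least[of s "\<lambda>j. \<exists>i<j. g i = g j"] unfolding j_def[symmetric] by auto
  qed auto
  let ?ks = "map g [i..<j]"
  have "last ?ks = g (j - 1)" "hd ?ks = g j"
    using i by (auto simp: last_map hd_map)
  moreover have "(g (j - 1), g j) \<in> E"
    using gE[of "j - 1"] i by simp
  ultimately have "(last ?ks, hd ?ks) \<in> E" by simp
  moreover have "distinct ?ks"
    using inj by (auto simp: distinct_map intro: inj_on_subset)
  moreover have "set ?ks \<subseteq> V" using gS \<open>S \<subseteq> V\<close> by auto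
  moreover have "(?ks ! s, ?ks ! Suc s) \<in> E" if "Suc s < length ?ks" for s
    using that gE[of "i + s"] by simp
  moreover have "?ks \<noteq> []" using i by simp
  ultimately have "is_cycle V E ?ks"
    unfolding is_cycle_def by (intro conjI allI impI)
  then show ?thesis by blast
qed

lemma outgoing_arrows_of_cycle:
  assumes "is_cycle V E ks" and "i \<in> set ks"
  shows "\<exists>j\<in>set ks. (i, j) \<in> E"
proof -
  obtain s where s: "s < length ks" "i = ks ! s"
    using assms(2) by (metis in_set_conv_nth)
  show ?thesis
  proof (cases "Suc s < length ks")
    case True
    then show ?thesis using assms(1) s unfolding is_cycle_def by (intro bexI[of _ "ks ! Suc s"]) auto
  next
    case False
    then have "i = last ks" using s last_conv_nth[of ks] by (cases "ks = []") (auto simp: not_less_eq less_Suc_eq)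
    then show ?thesis using assms(1) unfolding is_cycle_def by (intro bexI[of _ "hd ks"]) auto
  qed
qed

text \<open>
  This form of acyclicity drives the extinction argument: among the components not yet known to die
  there is one that is fed only by components that do.
\<close>

lemma acyclic_digraph_iff:
  assumes "finite V"
  shows "acyclic_digraph V E \<longleftrightarrow> (\<forall>S\<subseteq>V. S \<noteq> {} \<longrightarrow> (\<exists>i\<in>S. \<forall>j\<in>S. (i, j) \<notin> E))"
proof
  assume ac: "acyclic_digraph V E"
  show "\<forall>S\<subseteq>V. S \<noteq> {} \<longrightarrow> (\<exists>i\<in>S. \<forall>j\<in>S. (i, j) \<notin> E)"
  proof (intro allI impI, rule ccontr)
    fix S assume S: "S \<subseteq> V" "S \<noteq> {}" and "\<not> (\<exists>i\<in>S. \<forall>j\<in>S. (i, j) \<notin> E)"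
    then have "\<exists>ks. is_cycle V E ks"
      using cycle_of_outgoing_arrows[of S V E] finite_subset[OF S(1) assms] by blast
    then show False using ac unfolding acyclic_digraph_def by blast
  qed
next
  assume r: "\<forall>S\<subseteq>V. S \<noteq> {} \<longrightarrow> (\<exists>i\<in>S. \<forall>j\<in>S. (i, j) \<notin> E)"
  show "acyclic_digraph V E"
    unfolding acyclic_digraph_def
  proof
    assume "\<exists>ks. is_cycle V E ks"
    then obtain ks where ks: "is_cycle V E ks" ..
    then have "set ks \<subseteq> V" "set ks \<noteq> {}" by (auto simp: is_cycle_def)
    then obtain i where "i \<in> set ks" "\<forall>j\<in>set ks. (i, j) \<notin> E" using r by meson
    then show False using outgoing_arrows_of_cycle[OF ks, of i] by auto
  qed
qed

text \<open>
  The set is the vertex set of a cycle without chords: an inclusion-minimal nonempty set in which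
  every vertex keeps an outgoing arrow. Removing \<open>j\<close> breaks this property, so some vertex had
  \<open>j\<close> as its only out-neighbour in the set.
\<close>

lemma chordless_cycle_set:
  assumes "finite V" and "\<not> acyclic_digraph V E"
  shows "\<exists>S. S \<subseteq> V \<and> S \<noteq> {} \<and>
    (\<forall>j\<in>S. \<exists>i\<in>S. (i, j) \<in> E \<and> (\<forall>k\<in>S. k \<noteq> j \<longrightarrow> (i, k) \<notin> E))"
proof -
  define F where "F S \<longleftrightarrow> S \<subseteq> V \<and> S \<noteq> {} \<and> (\<forall>i\<in>S. \<exists>j\<in>S. (i, j) \<in> E)" for S
  have "\<exists>S. F S"
    using assms(2) unfolding acyclic_digraph_iff[OF assms(1)] F_def by meson
  then obtain S where S: "F S" and min: "\<And>S'. F S' \<Longrightarrow> card S \<le> card S'"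
    using ex_has_least_nat[of F _ card] by blast
  have fin: "finite S" using S assms(1) finite_subset unfolding F_def by blast
  show ?thesis
  proof (intro exI[of _ S] conjI ballI)
    show "S \<subseteq> V" "S \<noteq> {}" using S by (auto simp: F_def)
    fix j assume j: "j \<in> S"
    have "\<not> F (S - {j})"
      using min[of "S - {j}"] card_Diff1_less[OF fin j] by auto
    then consider "S = {j}" | i where "i \<in> S" "\<forall>k\<in>S - {j}. (i, k) \<notin> E"
      using S j unfolding F_def by fast
    then show "\<exists>i\<in>S. (i, j) \<in> E \<and> (\<forall>k\<in>S. k \<noteq> j \<longrightarrow> (i, k) \<notin> E)"
      using S unfolding F_def by cases blast+
  qed
qed

section \<open>Square integrable functions on the unit interval\<close>

lemma norm_L2_nonneg [simp]: "norm_L2 f \<ge> 0"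
  by (simp add: norm_L2_def)

lemma norm_L2_power2: "(norm_L2 f)\<^sup>2 = (\<integral>x. (f x)\<^sup>2 \<partial>lebesgue_on {0<..<1})"
  by (simp add: norm_L2_def)

lemma power2_diff_le: "(x - y)\<^sup>2 \<le> 2 * x\<^sup>2 + 2 * (y::real)\<^sup>2"
  using sum_squares_bound[of x "-y"] by (simp add: power2_diff)

lemma in_L2_diff:
  assumes "in_L2 f" "in_L2 g"
  shows "in_L2 (\<lambda>x. f x - g x)"
    and "(norm_L2 (\<lambda>x. f x - g x))\<^sup>2 \<le> 2 * (norm_L2 f)\<^sup>2 + 2 * (norm_L2 g)\<^sup>2"
proof -
  let ?M = "lebesgue_on {0<..<1::real}"
  have [measurable]: "f \<in> borel_measurable ?M" "g \<in> borel_measurable ?M"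
    and i: "integrable ?M (\<lambda>x. (f x)\<^sup>2)" "integrable ?M (\<lambda>x. (g x)\<^sup>2)"
    using assms by (auto simp: in_L2_def)
  have i2: "integrable ?M (\<lambda>x. 2 * (f x)\<^sup>2 + 2 * (g x)\<^sup>2)"
    using i by simp
  have "integrable ?M (\<lambda>x. (f x - g x)\<^sup>2)"
    by (rule Bochner_Integration.integrable_bound[OF i2]) (use power2_diff_le in auto)
  then show "in_L2 (\<lambda>x. f x - g x)" by (simp add: in_L2_def)
  have "(\<integral>x. (f x - g x)\<^sup>2 \<partial>?M) \<le> (\<integral>x. 2 * (f x)\<^sup>2 + 2 * (g x)\<^sup>2 \<partial>?M)"
    by (rule integral_mono) (use \<open>integrable ?M (\<lambda>x. (f x - g x)\<^sup>2)\<close> i2 power2_diff_le in auto)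
  also have "\<dots> = 2 * (norm_L2 f)\<^sup>2 + 2 * (norm_L2 g)\<^sup>2"
    using i by (simp add: norm_L2_power2)
  finally show "(norm_L2 (\<lambda>x. f x - g x))\<^sup>2 \<le> 2 * (norm_L2 f)\<^sup>2 + 2 * (norm_L2 g)\<^sup>2"
    by (simp add: norm_L2_power2)
qed

text \<open>
  The triangle inequality in squared form, at the price of a factor \<open>2\<close>: all bounds below are on
  squared norms, because these are energies.
\<close>

lemma norm_L2_triangle:
  assumes "in_L2 f" "in_L2 g" "in_L2 h"
  shows "(norm_L2 (\<lambda>x. f x - g x))\<^sup>2
    \<le> 2 * (norm_L2 (\<lambda>x. f x - h x))\<^sup>2 + 2 * (norm_L2 (\<lambda>x. g x - h x))\<^sup>2"
  using in_L2_diff(2)[OF in_L2_diff(1)[OF assms(1,3)] in_L2_diff(1)[OF assms(2,3)]] by simp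

lemma in_L2_continuous:
  assumes "continuous_on {0..1} f"
  shows "in_L2 f" and "(norm_L2 f)\<^sup>2 = integral {0..1} (\<lambda>x. (f x)\<^sup>2)"
proof -
  have c: "continuous_on {0..1} (\<lambda>x. (f x)\<^sup>2)" using assms by (intro continuous_intros)
  have "f \<in> borel_measurable (lebesgue_on {0..1})"
    using assms by (intro continuous_imp_measurable_on_sets_lebesgue) auto
  then have m: "f \<in> borel_measurable (lebesgue_on {0<..<1})"
    by (rule measurable_restrict_mono) auto
  have "integrable (lebesgue_on {0..1}) (\<lambda>x. (f x)\<^sup>2)"
    by (rule continuous_imp_integrable_real[OF c])
  then have i: "integrable (lebesgue_on {0<..<1}) (\<lambda>x. (f x)\<^sup>2)"
    using set_integrable_subset[of lebesgue "{0..1}" "\<lambda>x. (f x)\<^sup>2" "{0<..<1}"]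
    by (simp add: integrable_restrict_space set_integrable_def subset_iff)
  show "in_L2 f" using m i by (simp add: in_L2_def)
  show "(norm_L2 f)\<^sup>2 = integral {0..1} (\<lambda>x. (f x)\<^sup>2)"
    using lebesgue_integral_eq_integral[OF i]
    by (simp add: norm_L2_power2 integral_open_interval_real)
qed

text \<open>
  The conclusion keeps the rate: a bound on the tail of the sequence passes to the limit. Applied
  separately at each time, it thus gives convergence uniform in time.

  Along a subsequence with squared increments below \<open>(1/8)^i\<close>, the series of the squared
  increments weighted by \<open>2^i\<close> has a finite integral, hence converges almost everywhere. By
  \<open>2 \<bar>d\<bar> \<le> 2^i d\<^sup>2 + 2^(-i)\<close> the increments are then absolutely summable. Fatou's lemma
  bounds the distance to the pointwise limit.
\<close>

lemma L2_complete:
  fixes f :: "nat \<Rightarrow> real \<Rightarrow> real"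
  assumes L2: "\<And>l. in_L2 (f l)"
    and Cauchy: "\<And>e. e > 0 \<Longrightarrow> \<exists>N. \<forall>k\<ge>N. \<forall>l\<ge>N. (norm_L2 (\<lambda>x. f k x - f l x))\<^sup>2 \<le> e"
  obtains g where "in_L2 g"
    "\<And>e N l. (\<And>k. k \<ge> N \<Longrightarrow> (norm_L2 (\<lambda>x. f k x - f l x))\<^sup>2 \<le> e)
       \<Longrightarrow> (norm_L2 (\<lambda>x. g x - f l x))\<^sup>2 \<le> e"
proof -
  let ?M = "lebesgue_on {0<..<1::real}"
  have [measurable]: "f l \<in> borel_measurable ?M" for l
    using L2 by (auto simp: in_L2_def)
  have id: "integrable ?M (\<lambda>x. (f k x - f l x)\<^sup>2)" for k l
    using in_L2_diff(1)[OF L2 L2] by (simp add: in_L2_def)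
  have nn: "(\<integral>\<^sup>+x. ennreal ((f k x - f l x)\<^sup>2) \<partial>?M) = ennreal ((norm_L2 (\<lambda>x. f k x - f l x))\<^sup>2)" for k l
    using nn_integral_eq_integral[OF id] by (simp add: norm_L2_power2)
  have "\<exists>N. \<forall>i. (\<forall>k\<ge>N i. \<forall>l\<ge>N i. (norm_L2 (\<lambda>x. f k x - f l x))\<^sup>2 \<le> (1/8)^i)"
    by (rule choice) (use Cauchy in auto)
  then obtain N where N: "\<And>i k l. k \<ge> N i \<Longrightarrow> l \<ge> N i \<Longrightarrow> (norm_L2 (\<lambda>x. f k x - f l x))\<^sup>2 \<le> (1/8)^i"
    by blast
  \<comment> \<open>the sum makes \<open>n i\<close> increase past every earlier \<open>N j\<close>, so both \<open>n i\<close> and \<open>n (Suc i)\<close> are beyond \<open>N i\<close>\<close>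
  define n where "n i = i + (\<Sum>j\<le>i. N j)" for i
  have nN: "n i \<ge> N i" "n (Suc i) \<ge> N i" "n i \<ge> i" for i
    using member_le_sum[of i "{..i}" N] by (auto simp: n_def)
  define d where "d i x = f (n (Suc i)) x - f (n i) x" for i x
  have [measurable]: "d i \<in> borel_measurable ?M" for i
    unfolding d_def by measurable
  have "(\<integral>\<^sup>+x. (\<Sum>i. ennreal (2^i * (d i x)\<^sup>2)) \<partial>?M) = (\<Sum>i. \<integral>\<^sup>+x. ennreal (2^i * (d i x)\<^sup>2) \<partial>?M)"
    by (rule nn_integral_suminf) measurable
  also have "\<dots> \<le> (\<Sum>i. ennreal ((1/4)^i))"
  proof (rule suminf_le)
    fix i
    have "(\<integral>\<^sup>+x. ennreal (2^i * (d i x)\<^sup>2) \<partial>?M) = 2^i * (\<integral>\<^sup>+x. ennreal ((d i x)\<^sup>2) \<partial>?M)"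
      by (subst nn_integral_cmult[symmetric]) (auto simp: ennreal_mult ennreal_power[symmetric])
    also have "\<dots> = ennreal (2^i * (norm_L2 (\<lambda>x. f (n (Suc i)) x - f (n i) x))\<^sup>2)"
      unfolding d_def nn by (simp add: ennreal_mult ennreal_power[symmetric])
    also have "\<dots> \<le> ennreal (2^i * (1/8)^i)"
      by (intro ennreal_leI mult_left_mono N nN) auto
    also have "2^i * (1/8)^i = (1/4::real)^i"
      by (simp flip: power_mult_distrib)
    finally show "(\<integral>\<^sup>+x. ennreal (2^i * (d i x)\<^sup>2) \<partial>?M) \<le> ennreal ((1/4)^i)" .
  qed auto
  also have "\<dots> = ennreal (\<Sum>i. (1/4)^i)"
    by (rule suminf_ennreal2) auto
  also have "\<dots> < \<infinity>" by simp
  finally have "(\<integral>\<^sup>+x. (\<Sum>i. ennreal (2^i * (d i x)\<^sup>2)) \<partial>?M) \<noteq> \<infinity>" by auto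
  then have "AE x in ?M. (\<Sum>i. ennreal (2^i * (d i x)\<^sup>2)) \<noteq> \<infinity>"
    by (intro nn_integral_PInf_AE) measurable
  then have conv: "AE x in ?M. convergent (\<lambda>i. f (n i) x)"
  proof (rule AE_mp, intro AE_I2 impI)
    fix x assume "(\<Sum>i. ennreal (2^i * (d i x)\<^sup>2)) \<noteq> \<infinity>"
    then have s: "summable (\<lambda>i. 2^i * (d i x)\<^sup>2)"
      by (intro summable_suminf_not_top) auto
    have s2: "summable (\<lambda>i. (2^i * (d i x)\<^sup>2 + (1/2)^i) / 2)"
      by (intro summable_divide summable_add s) simp
    have "summable (\<lambda>i. d i x)"
    proof (rule summable_comparison_test[OF _ s2], intro exI allI impI)
      fix i
      \<comment> \<open>arithmetic-geometric mean inequality, written as a square\<close>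
      have "0 \<le> (2^i * \<bar>d i x\<bar> - 1)\<^sup>2 / 2^i" by simp
      also have "\<dots> = 2^i * (d i x)\<^sup>2 + (1/2)^i - 2 * \<bar>d i x\<bar>"
        by (simp add: power2_eq_square field_simps)
      finally show "norm (d i x) \<le> (2^i * (d i x)\<^sup>2 + (1/2)^i) / 2" by simp
    qed
    then have "convergent (\<lambda>k. f (n 0) x + (\<Sum>i<k. d i x))"
      by (intro convergent_add convergent_const) (simp add: summable_iff_convergent)
    also have "(\<lambda>k. f (n 0) x + (\<Sum>i<k. d i x)) = (\<lambda>k. f (n k) x)"
      unfolding d_def by (subst sum_lessThan_telescope) simp
    finally show "convergent (\<lambda>i. f (n i) x)" .
  qed
  define g where "g x = lim (\<lambda>i. f (n i) x)" for x
  have [measurable]: "g \<in> borel_measurable ?M"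
    unfolding g_def by measurable
  have key: "integrable ?M (\<lambda>x. (g x - f l x)\<^sup>2) \<and> (norm_L2 (\<lambda>x. g x - f l x))\<^sup>2 \<le> e"
    if b: "\<And>k. k \<ge> N0 \<Longrightarrow> (norm_L2 (\<lambda>x. f k x - f l x))\<^sup>2 \<le> e" for e N0 l
  proof -
    have e: "e \<ge> 0" using b[of N0] zero_le_power2 order_trans by blast
    have "(\<integral>\<^sup>+x. ennreal ((g x - f l x)\<^sup>2) \<partial>?M) = (\<integral>\<^sup>+x. liminf (\<lambda>i. ennreal ((f (n i) x - f l x)\<^sup>2)) \<partial>?M)"
    proof (rule nn_integral_cong_AE, rule AE_mp[OF conv], intro AE_I2 impI)
      fix x assume "convergent (\<lambda>i. f (n i) x)"
      then have "(\<lambda>i. f (n i) x) \<longlonglongrightarrow> g x" unfolding g_def by (rule convergent_LIMSEQ_iff[THEN iffD1])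
      then have "(\<lambda>i. ennreal ((f (n i) x - f l x)\<^sup>2)) \<longlonglongrightarrow> ennreal ((g x - f l x)\<^sup>2)"
        by (intro tendsto_intros)
      then show "ennreal ((g x - f l x)\<^sup>2) = liminf (\<lambda>i. ennreal ((f (n i) x - f l x)\<^sup>2))"
        by (intro lim_imp_Liminf[symmetric]) auto
    qed
    also have "\<dots> \<le> liminf (\<lambda>i. \<integral>\<^sup>+x. ennreal ((f (n i) x - f l x)\<^sup>2) \<partial>?M)"
      by (rule nn_integral_liminf) measurable
    also have "\<dots> \<le> liminf (\<lambda>i::nat. ennreal e)"
    proof (rule Liminf_mono)
      show "\<forall>\<^sub>F i in sequentially. (\<integral>\<^sup>+x. ennreal ((f (n i) x - f l x)\<^sup>2) \<partial>?M) \<le> ennreal e"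
        using eventually_ge_at_top[of N0]
      proof eventually_elim
        case (elim i)
        then have "n i \<ge> N0" using nN(3)[of i] by simp
        then show ?case unfolding nn by (intro ennreal_leI b)
      qed
    qed
    also have "\<dots> = ennreal e" by (simp add: Liminf_const)
    finally have le: "(\<integral>\<^sup>+x. ennreal ((g x - f l x)\<^sup>2) \<partial>?M) \<le> ennreal e" .
    have i: "integrable ?M (\<lambda>x. (g x - f l x)\<^sup>2)"
      by (rule integrableI_nonneg) (use le in \<open>auto simp: order_le_less_trans\<close>)
    moreover have "(norm_L2 (\<lambda>x. g x - f l x))\<^sup>2 \<le> e"
      using le nn_integral_eq_integral[OF i] e by (simp add: norm_L2_power2)
    ultimately show ?thesis by blast
  qed
  obtain N1 where N1: "\<forall>k\<ge>N1. \<forall>l\<ge>N1. (norm_L2 (\<lambda>x. f k x - f l x))\<^sup>2 \<le> 1"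
    using Cauchy[of 1] by auto
  have "in_L2 (\<lambda>x. g x - f N1 x)"
    using key[of N1 N1 1] N1 by (auto simp: in_L2_def)
  moreover have "in_L2 (\<lambda>x. - f N1 x)"
    using L2[of N1] by (auto simp: in_L2_def)
  ultimately have "in_L2 g"
    using in_L2_diff(1) by fastforce
  then show ?thesis using key that by blast
qed

section \<open>Weighted energies of a transported function\<close>

text \<open>
  The initial point is excluded from the differential inequality because the transport equation is
  only imposed for positive times.
\<close>

lemma gronwall:
  fixes E E' :: "real \<Rightarrow> real"
  assumes "continuous_on {t0..} E"
    and "\<And>s. s > t0 \<Longrightarrow> (E has_real_derivative E' s) (at s)"
    and "\<And>s. s > t0 \<Longrightarrow> E' s \<le> K * E s"
    and "t \<ge> t0"
  shows "E t \<le> exp (K * (t - t0)) * E t0"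
proof -
  \<comment> \<open>the integrating factor makes \<open>h\<close> nonincreasing\<close>
  define h where "h s = exp (- K * (s - t0)) * E s" for s
  have "h t \<le> h t0"
  proof (rule DERIV_nonpos_imp_decreasing_open[OF \<open>t \<ge> t0\<close>])
    fix s assume "t0 < s" "s < t"
    have "(h has_real_derivative exp (- K * (s - t0)) * (E' s - K * E s)) (at s)"
      unfolding h_def
      by (auto intro!: derivative_eq_intros assms(2) \<open>t0 < s\<close> simp: algebra_simps)
    moreover have "exp (- K * (s - t0)) * (E' s - K * E s) \<le> 0"
      using assms(3)[OF \<open>t0 < s\<close>] by (intro mult_nonneg_nonpos) auto
    ultimately show "\<exists>y. (h has_real_derivative y) (at s) \<and> y \<le> 0" by blast
  next
    show "continuous_on {t0..t} h"
      unfolding h_def by (intro continuous_intros continuous_on_subset[OF assms(1)]) auto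
  qed
  then have "exp (K * (t - t0)) * h t \<le> exp (K * (t - t0)) * h t0" by simp
  then show ?thesis by (simp add: h_def mult.assoc[symmetric] exp_add[symmetric])
qed

lemma C1_with_partials_DERIV_x:
  assumes "C1_with_partials u ux ut" "x \<in> {0..1}" "t \<ge> 0"
  shows "((\<lambda>y. u (y, t)) has_real_derivative ux (x, t)) (at x within {0..1})"
proof -
  have "(u has_derivative (\<lambda>(h, k). ux (x, t) * h + ut (x, t) * k)) (at (x, t) within Pi_strip)"
    using assms by (auto simp: C1_with_partials_def Pi_strip_def)
  then have "(u has_derivative (\<lambda>(h, k). ux (x, t) * h + ut (x, t) * k)) (at (x, t) within (\<lambda>y. (y, t)) ` {0..1})"
    by (rule has_derivative_subset) (use assms in \<open>auto simp: Pi_strip_def\<close>)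
  moreover have "((\<lambda>y. (y, t)) has_derivative (\<lambda>h. (h, 0))) (at x within {0..1})"
    by (auto intro!: derivative_eq_intros)
  ultimately have "((u \<circ> (\<lambda>y. (y, t))) has_derivative ((\<lambda>(h, k). ux (x, t) * h + ut (x, t) * k) \<circ> (\<lambda>h. (h, 0)))) (at x within {0..1})"
    by (intro diff_chain_within) simp_all
  then have "((\<lambda>y. u (y, t)) has_derivative (\<lambda>h. ux (x, t) * h)) (at x within {0..1})"
    by (simp add: o_def)
  then show ?thesis by (simp add: has_field_derivative_def)
qed

lemma C1_with_partials_DERIV_t:
  assumes "C1_with_partials u ux ut" "x \<in> {0..1}" "t \<ge> 0"
  shows "((\<lambda>s. u (x, s)) has_real_derivative ut (x, t)) (at t within {0..})"
proof -
  have "(u has_derivative (\<lambda>(h, k). ux (x, t) * h + ut (x, t) * k)) (at (x, t) within Pi_strip)"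
    using assms by (auto simp: C1_with_partials_def Pi_strip_def)
  then have "(u has_derivative (\<lambda>(h, k). ux (x, t) * h + ut (x, t) * k)) (at (x, t) within (\<lambda>s. (x, s)) ` {0..})"
    by (rule has_derivative_subset) (use assms in \<open>auto simp: Pi_strip_def\<close>)
  moreover have "((\<lambda>s. (x, s)) has_derivative (\<lambda>k. (0, k))) (at t within {0..})"
    by (auto intro!: derivative_eq_intros)
  ultimately have "((u \<circ> (\<lambda>s. (x, s))) has_derivative ((\<lambda>(h, k). ux (x, t) * h + ut (x, t) * k) \<circ> (\<lambda>k. (0, k)))) (at t within {0..})"
    by (intro diff_chain_within) simp_all
  then have "((\<lambda>s. u (x, s)) has_derivative (\<lambda>h. ut (x, t) * h)) (at t within {0..})"
    by (simp add: o_def)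
  then show ?thesis by (simp add: has_field_derivative_def)
qed

lemma C1_with_partials_continuous:
  assumes "C1_with_partials u ux ut"
  shows "continuous_on Pi_strip u" "continuous_on Pi_strip ux" "continuous_on Pi_strip ut"
proof -
  show "continuous_on Pi_strip u"
    unfolding continuous_on_eq_continuous_within
  proof
    fix z assume "z \<in> Pi_strip"
    then have "(u has_derivative (\<lambda>(h, k). ux z * h + ut z * k)) (at z within Pi_strip)"
      using assms by (simp add: C1_with_partials_def)
    then show "continuous (at z within Pi_strip) u" by (rule has_derivative_continuous)
  qed
qed (use assms in \<open>simp_all add: C1_with_partials_def\<close>)

lemma continuous_on_strip_x:
  assumes "continuous_on Pi_strip u" "t \<ge> 0"
  shows "continuous_on {0..1} (\<lambda>x. u (x, t))"
  by (rule continuous_on_compose2[OF assms(1)]) (use assms(2) in \<open>auto simp: Pi_strip_def intro!: continuous_intros\<close>)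

text \<open>
  The partial derivatives are parameters, so that the equation can be integrated without reference to
  \<open>deriv\<close>.
\<close>

definition transports ::
  "(real \<times> real \<Rightarrow> real) \<Rightarrow> (real \<times> real \<Rightarrow> real) \<Rightarrow> (real \<times> real \<Rightarrow> real) \<Rightarrow>
   (real \<times> real \<Rightarrow> real) \<Rightarrow> (real \<times> real \<Rightarrow> real) \<Rightarrow> bool" where
  "transports a b u ux ut \<longleftrightarrow> C1_with_partials u ux ut \<and>
     (\<forall>x t. 0 < x \<and> x < 1 \<and> 0 < t \<longrightarrow> ut (x, t) + a (x, t) * ux (x, t) + b (x, t) * u (x, t) = 0)"

definition energy :: "real \<Rightarrow> real \<Rightarrow> (real \<times> real \<Rightarrow> real) \<Rightarrow> real \<Rightarrow> real" where
  "energy k c u t = integral {0..1} (\<lambda>x. exp (k + c * x) * (u (x, t))\<^sup>2)"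

lemma energy_deriv_raw:
  assumes u: "C1_with_partials u ux ut" and "t \<ge> 0"
  shows "(energy k c u has_real_derivative
    integral {0..1} (\<lambda>x. exp (k + c * x) * (2 * u (x, t) * ut (x, t)))) (at t within {0..})"
proof -
  note c = C1_with_partials_continuous[OF u]
  have "((\<lambda>s. integral (cbox 0 1) (\<lambda>x. exp (k + c * x) * (u (x, s))\<^sup>2)) has_real_derivative
    integral (cbox 0 1) (\<lambda>x. exp (k + c * x) * (2 * u (x, t) * ut (x, t)))) (at t within {0..})"
  proof (rule leibniz_rule_field_derivative)
    fix s x :: real assume "s \<in> {0..}" "x \<in> cbox 0 1"
    then show "((\<lambda>s. exp (k + c * x) * (u (x, s))\<^sup>2) has_real_derivative
        exp (k + c * x) * (2 * u (x, s) * ut (x, s))) (at s within {0..})"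
      by (auto intro!: derivative_eq_intros C1_with_partials_DERIV_t[OF u])
  next
    fix s :: real assume "s \<in> {0..}"
    then show "(\<lambda>x. exp (k + c * x) * (u (x, s))\<^sup>2) integrable_on cbox 0 1"
      by (intro integrable_continuous continuous_intros)
        (use continuous_on_strip_x[OF c(1), of s] in auto)
  next
    have sw: "continuous_on ({0..} \<times> {0..1}) (\<lambda>z. f (snd z, fst z))"
      if "continuous_on Pi_strip f" for f :: "real \<times> real \<Rightarrow> real"
      by (rule continuous_on_compose2[OF that]) (auto simp: Pi_strip_def intro!: continuous_intros)
    show "continuous_on ({0..} \<times> cbox 0 1) (\<lambda>(s, x). exp (k + c * x) * (2 * u (x, s) * ut (x, s)))"
      unfolding case_prod_beta
      by (intro continuous_intros) (use sw[OF c(1)] sw[OF c(3)] in auto)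
  qed (use \<open>t \<ge> 0\<close> in auto)
  then show ?thesis by (simp add: energy_def[abs_def])
qed

lemma energy_continuous:
  assumes "C1_with_partials u ux ut"
  shows "continuous_on {0..} (energy k c u)"
  unfolding continuous_on_eq_continuous_within
  using DERIV_continuous[OF energy_deriv_raw[OF assms]] by simp

text \<open>
  Differentiate under the integral sign and replace the time derivative by means of the equation. The
  integrand then is minus the \<open>x\<close>-derivative of \<open>exp (k + c * x) * a * u\<^sup>2\<close>, which integrates to the
  boundary flux, plus a bulk term of order zero in \<open>u\<close>. The weight contributes \<open>c * a\<close> to the bulk
  term, and this is the contribution whose sign and size can be chosen.
\<close>

lemma energy_derivative:
  assumes u: "transports a b u ux ut" and a: "C1_with_partials a ax at'"
    and b: "continuous_on Pi_strip b" and t: "t > 0"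
  shows "(energy k c u has_real_derivative
    exp k * (a (0, t) * (u (0, t))\<^sup>2) - exp (k + c) * (a (1, t) * (u (1, t))\<^sup>2)
    + integral {0..1} (\<lambda>x. (c * a (x, t) + ax (x, t) - 2 * b (x, t)) * (exp (k + c * x) * (u (x, t))\<^sup>2))) (at t)"
proof -
  have uC: "C1_with_partials u ux ut" using u by (simp add: transports_def)
  note cu = C1_with_partials_continuous[OF uC] and ca = C1_with_partials_continuous[OF a]
  note cx = continuous_on_strip_x[of _ t]
  let ?G = "\<lambda>x. exp (k + c * x) * (a (x, t) * (u (x, t))\<^sup>2)"
  let ?R = "\<lambda>x. (c * a (x, t) + ax (x, t) - 2 * b (x, t)) * (exp (k + c * x) * (u (x, t))\<^sup>2)"
  let ?G' = "\<lambda>x. exp (k + c * x) * ((c * a (x, t) + ax (x, t)) * (u (x, t))\<^sup>2 + a (x, t) * (2 * u (x, t) * ux (x, t)))"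
  have G: "(?G' has_integral ?G 1 - ?G 0) {0..1}"
    by (rule fundamental_theorem_of_calculus)
      (use t in \<open>auto simp: has_real_derivative_iff_has_vector_derivative[symmetric] algebra_simps power2_eq_square
         intro!: derivative_eq_intros C1_with_partials_DERIV_x[OF uC] C1_with_partials_DERIV_x[OF a]\<close>)
  have R: "?R integrable_on {0..1}"
    by (intro integrable_continuous_interval continuous_intros cx cu ca b) (use t in auto)
  have "integral {0..1} (\<lambda>x. exp (k + c * x) * (2 * u (x, t) * ut (x, t))) = integral {0..1} (\<lambda>x. ?R x - ?G' x)"
  \<comment> \<open>the equation is only known in the interior; the two endpoints do not affect the integral\<close>
  proof (rule integral_spike[where S = "{0, 1}"])
    fix x :: real assume "x \<in> {0..1} - {0, 1}"
    then have "ut (x, t) + a (x, t) * ux (x, t) + b (x, t) * u (x, t) = 0"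
      using u t by (auto simp: transports_def)
    then have *: "ut (x, t) = - a (x, t) * ux (x, t) - b (x, t) * u (x, t)"
      by linarith
    show "?R x - ?G' x = exp (k + c * x) * (2 * u (x, t) * ut (x, t))"
      unfolding * by (simp add: algebra_simps power2_eq_square)
  qed auto
  also have "\<dots> = integral {0..1} ?R - (?G 1 - ?G 0)"
    using G R by (subst integral_diff) (auto simp: integral_unique)
  also have "\<dots> = exp k * (a (0, t) * (u (0, t))\<^sup>2) - exp (k + c) * (a (1, t) * (u (1, t))\<^sup>2) + integral {0..1} ?R"
    by simp
  finally have eq: "integral {0..1} (\<lambda>x. exp (k + c * x) * (2 * u (x, t) * ut (x, t))) = \<dots>" .
  have at: "at t within {0..} = at t"
    using t by (intro at_within_interior) simp
  show ?thesis
    using energy_deriv_raw[OF uC, of t k c] t unfolding at eq by simp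
qed

lemma energy_mono_weight:
  assumes "continuous_on Pi_strip u" "t \<ge> 0" "continuous_on {0..1} r"
    and "\<And>x. x \<in> {0..1} \<Longrightarrow> r x \<le> K"
  shows "integral {0..1} (\<lambda>x. r x * (exp (k + c * x) * (u (x, t))\<^sup>2)) \<le> K * energy k c u t"
proof -
  have "integral {0..1} (\<lambda>x. r x * (exp (k + c * x) * (u (x, t))\<^sup>2))
      \<le> integral {0..1} (\<lambda>x. K * (exp (k + c * x) * (u (x, t))\<^sup>2))"
    by (intro integral_le integrable_continuous_interval continuous_intros continuous_on_strip_x assms(1-3) mult_right_mono) (use assms(4) in auto)
  then show ?thesis by (simp add: energy_def)
qed

lemma energy_integrable:
  assumes "continuous_on Pi_strip u" "t \<ge> 0"
  shows "(\<lambda>x. exp (k + c * x) * (u (x, t))\<^sup>2) integrable_on {0..1}"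
  by (intro integrable_continuous_interval continuous_intros continuous_on_strip_x assms)

lemma energy_le:
  assumes u: "continuous_on Pi_strip u" and t: "t \<ge> 0"
    and le: "\<And>x. x \<in> {0..1} \<Longrightarrow> k + c * x \<le> k' + c' * x"
  shows "energy k c u t \<le> energy k' c' u t"
  unfolding energy_def
proof (rule integral_le)
  fix x :: real assume "x \<in> {0..1}"
  from le[OF this] show "exp (k + c * x) * (u (x, t))\<^sup>2 \<le> exp (k' + c' * x) * (u (x, t))\<^sup>2"
    by (intro mult_right_mono) (simp_all only: exp_le_cancel_iff zero_le_power2)
qed (use energy_integrable[OF u t] in blast)+

section \<open>Classical solutions and extinction under zero inflow\<close>

lemma classical_solution_transports:
  assumes "classical_solution n m p a b \<phi> u" "j \<in> {1..n}"
  shows "\<exists>ux ut. transports (a j) (b j) (u j) ux ut"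
proof -
  obtain ux ut where c: "C1_with_partials (u j) ux ut"
    using assms unfolding classical_solution_def C1_Pi_def by blast
  have "ut (x, t) + a j (x, t) * ux (x, t) + b j (x, t) * u j (x, t) = 0"
    if "0 < x" "x < 1" "0 < t" for x t
  proof -
    have "at x within {0..1} = at x" using that by (intro at_within_interior) simp
    then have "deriv (\<lambda>y. u j (y, t)) x = ux (x, t)"
      using C1_with_partials_DERIV_x[OF c, of x t] that by (simp add: DERIV_imp_deriv)
    moreover have "at t within {0..} = at t" using that by (intro at_within_interior) simp
    then have "deriv (\<lambda>s. u j (x, s)) t = ut (x, t)"
      using C1_with_partials_DERIV_t[OF c, of x t] that by (simp add: DERIV_imp_deriv)
    ultimately show ?thesis
      using assms that unfolding classical_solution_def by metis
  qed
  then show ?thesis using c unfolding transports_def by blast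
qed

lemma C1_with_partials_diff:
  assumes "C1_with_partials u ux ut" "C1_with_partials v vx vt"
  shows "C1_with_partials (\<lambda>z. u z - v z) (\<lambda>z. ux z - vx z) (\<lambda>z. ut z - vt z)"
  unfolding C1_with_partials_def
proof (intro conjI ballI)
  fix z assume "z \<in> Pi_strip"
  then have "((\<lambda>z. u z - v z) has_derivative
      (\<lambda>y. (\<lambda>(h, k). ux z * h + ut z * k) y - (\<lambda>(h, k). vx z * h + vt z * k) y)) (at z within Pi_strip)"
    using assms by (intro has_derivative_diff) (simp_all add: C1_with_partials_def)
  moreover have "(\<lambda>y. (\<lambda>(h, k). ux z * h + ut z * k) y - (\<lambda>(h, k). vx z * h + vt z * k) y)
      = (\<lambda>(h, k). (ux z - vx z) * h + (ut z - vt z) * k)"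
    by (auto simp: algebra_simps)
  ultimately show "((\<lambda>z. u z - v z) has_derivative (\<lambda>(h, k). (ux z - vx z) * h + (ut z - vt z) * k))
      (at z within Pi_strip)" by simp
qed (use assms in \<open>auto simp: C1_with_partials_def intro!: continuous_intros\<close>)

text \<open>
  Linearity is what turns the energy bound for one solution into continuous dependence on the data.
\<close>

lemma classical_solution_diff:
  assumes u: "classical_solution n m p a b \<phi> u" and v: "classical_solution n m p a b \<psi> v"
  shows "classical_solution n m p a b (\<lambda>j x. \<phi> j x - \<psi> j x) (\<lambda>j z. u j z - v j z)"
proof -
  have C1: "C1_Pi (\<lambda>z. u j z - v j z)" if "j \<in> {1..n}" for j
  proof -
    have "C1_Pi (u j)" "C1_Pi (v j)" using u v that by (auto simp: classical_solution_def)
    then show ?thesis unfolding C1_Pi_def using C1_with_partials_diff by blast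
  qed
  have pde: "deriv (\<lambda>s. u j (x, s) - v j (x, s)) t + a j (x, t) * deriv (\<lambda>y. u j (y, t) - v j (y, t)) x
      + b j (x, t) * (u j (x, t) - v j (x, t)) = 0"
    if j: "j \<in> {1..n}" and x: "0 < x \<and> x < 1 \<and> 0 < t" for j x t
  proof -
    obtain ux ut where tu: "transports (a j) (b j) (u j) ux ut"
      using classical_solution_transports[OF u j] by blast
    obtain vx vt where tv: "transports (a j) (b j) (v j) vx vt"
      using classical_solution_transports[OF v j] by blast
    have cu: "C1_with_partials (u j) ux ut" and cv: "C1_with_partials (v j) vx vt"
      using tu tv by (auto simp: transports_def)
    have atx: "at x within {0..1} = at x" using x by (intro at_within_interior) simp
    have att: "at t within {0..} = at t" using x by (intro at_within_interior) simp
    have dx: "deriv (\<lambda>y. u j (y, t) - v j (y, t)) x = ux (x, t) - vx (x, t)"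
      using C1_with_partials_DERIV_x[OF C1_with_partials_diff[OF cu cv], of x t] x atx
      by (intro DERIV_imp_deriv) auto
    have dt: "deriv (\<lambda>s. u j (x, s) - v j (x, s)) t = ut (x, t) - vt (x, t)"
      using C1_with_partials_DERIV_t[OF C1_with_partials_diff[OF cu cv], of x t] x att
      by (intro DERIV_imp_deriv) auto
    have "ut (x, t) + a j (x, t) * ux (x, t) + b j (x, t) * u j (x, t) = 0"
      "vt (x, t) + a j (x, t) * vx (x, t) + b j (x, t) * v j (x, t) = 0"
      using tu tv x by (auto simp: transports_def)
    then show ?thesis unfolding dx dt by (simp add: algebra_simps)
  qed
  have bv: "boundary_value n m p (\<lambda>j z. u j z - v j z) j t
      = boundary_value n m p u j t - boundary_value n m p v j t" for j t
    by (simp add: boundary_value_def sum_subtractf right_diff_distrib)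
  show ?thesis
    unfolding classical_solution_def
  proof (intro conjI ballI allI impI)
    show "C1_Pi (\<lambda>z. u j z - v j z)" if "j \<in> {1..n}" for j by (rule C1[OF that])
  qed (use u v pde in \<open>simp_all add: bv classical_solution_def\<close>)
qed

lemma classical_solution_C1:
  assumes "classical_solution n m p a b \<phi> u" "j \<in> {1..n}"
  obtains ux ut where "C1_with_partials (u j) ux ut"
  using assms unfolding classical_solution_def C1_Pi_def by blast

lemma classical_solution_continuous:
  assumes "classical_solution n m p a b \<phi> u" "j \<in> {1..n}"
  shows "continuous_on Pi_strip (u j)"
  using classical_solution_C1[OF assms] C1_with_partials_continuous(1) by metis

text \<open>
  Explicit constants of an admissible system: all estimates below depend on the coefficients only
  through \<open>a0\<close> and \<open>A\<close>.
\<close>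

definition speed_bounds ::
  "nat \<Rightarrow> nat \<Rightarrow> (nat \<Rightarrow> real \<times> real \<Rightarrow> real) \<Rightarrow> (nat \<Rightarrow> real \<times> real \<Rightarrow> real) \<Rightarrow>
   real \<Rightarrow> real \<Rightarrow> (nat \<Rightarrow> real \<times> real \<Rightarrow> real) \<Rightarrow> (nat \<Rightarrow> real \<times> real \<Rightarrow> real) \<Rightarrow> bool" where
  "speed_bounds n m a b a0 A ax at' \<longleftrightarrow> a0 > 0 \<and> A \<ge> 0 \<and>
     (\<forall>j\<in>{1..m}. \<forall>z\<in>Pi_strip. a j z \<ge> a0) \<and> (\<forall>j\<in>{m+1..n}. \<forall>z\<in>Pi_strip. a j z \<le> - a0) \<and>
     (\<forall>j\<in>{1..n}. C1_with_partials (a j) (ax j) (at' j) \<and> continuous_on Pi_strip (b j)) \<and>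
     (\<forall>j\<in>{1..n}. \<forall>z\<in>Pi_strip. \<bar>a j z\<bar> \<le> A \<and> \<bar>ax j z\<bar> \<le> A \<and> \<bar>b j z\<bar> \<le> A)"

lemma admissible_speed_bounds:
  assumes "admissible n m a b"
  obtains a0 A ax at' where "speed_bounds n m a b a0 A ax at'"
proof -
  obtain a0 where a0: "a0 > 0" "\<forall>j\<in>{1..m}. \<forall>z\<in>Pi_strip. a j z \<ge> a0"
      "\<forall>j\<in>{m+1..n}. \<forall>z\<in>Pi_strip. a j z \<le> - a0"
    using assms unfolding admissible_def by blast
  have "\<forall>j\<in>{1..n}. \<exists>ax at' A. C1_with_partials (a j) ax at' \<and> continuous_on Pi_strip (b j) \<and>
      (\<forall>z\<in>Pi_strip. \<bar>a j z\<bar> \<le> A \<and> \<bar>ax z\<bar> \<le> A \<and> \<bar>b j z\<bar> \<le> A)"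
  proof
    fix j assume "j \<in> {1..n}"
    then have "bounded_C1_Pi (a j)" "bounded_C1_Pi (b j)"
      using assms by (auto simp: admissible_def)
    then obtain ax at' bx bt where c: "C1_with_partials (a j) ax at'" "bounded (a j ` Pi_strip)"
        "bounded (ax ` Pi_strip)" "C1_with_partials (b j) bx bt" "bounded (b j ` Pi_strip)"
      unfolding bounded_C1_Pi_def by blast
    obtain B1 B2 B3 where B: "\<forall>z\<in>Pi_strip. \<bar>a j z\<bar> \<le> B1" "\<forall>z\<in>Pi_strip. \<bar>ax z\<bar> \<le> B2"
        "\<forall>z\<in>Pi_strip. \<bar>b j z\<bar> \<le> B3"
      using c(2,3,5) unfolding bounded_iff by auto
    have "\<forall>z\<in>Pi_strip. \<bar>a j z\<bar> \<le> max B1 (max B2 B3) \<and> \<bar>ax z\<bar> \<le> max B1 (max B2 B3)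
        \<and> \<bar>b j z\<bar> \<le> max B1 (max B2 B3)"
      using B by (auto simp: le_max_iff_disj)
    then show "\<exists>ax at' A. C1_with_partials (a j) ax at' \<and> continuous_on Pi_strip (b j) \<and>
      (\<forall>z\<in>Pi_strip. \<bar>a j z\<bar> \<le> A \<and> \<bar>ax z\<bar> \<le> A \<and> \<bar>b j z\<bar> \<le> A)"
      using c(1) C1_with_partials_continuous(1)[OF c(4)] by blast
  qed
  then obtain ax at' A where A: "\<And>j. j \<in> {1..n} \<Longrightarrow> C1_with_partials (a j) (ax j) (at' j)"
     "\<And>j. j \<in> {1..n} \<Longrightarrow> continuous_on Pi_strip (b j)"
     "\<And>j z. j \<in> {1..n} \<Longrightarrow> z \<in> Pi_strip \<Longrightarrow> \<bar>a j z\<bar> \<le> A j \<and> \<bar>ax j z\<bar> \<le> A j \<and> \<bar>b j z\<bar> \<le> A j"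
    by metis
  let ?A = "\<Sum>j=1..n. \<bar>A j\<bar>"
  have le: "A j \<le> ?A" if "j \<in> {1..n}" for j
    using member_le_sum[of j "{1..n}" "\<lambda>j. \<bar>A j\<bar>"] that by auto
  have "?A \<ge> 0" by (simp add: sum_nonneg)
  moreover have "\<bar>a j z\<bar> \<le> ?A \<and> \<bar>ax j z\<bar> \<le> ?A \<and> \<bar>b j z\<bar> \<le> ?A" if "j \<in> {1..n}" "z \<in> Pi_strip" for j z
    using A(3)[OF that] le[OF that(1)] by linarith
  ultimately have "speed_bounds n m a b a0 ?A ax at'"
    unfolding speed_bounds_def using a0 A(1,2) by blast
  then show ?thesis by (rule that)
qed

lemma strip_mem [simp]: "(x, t) \<in> Pi_strip \<longleftrightarrow> 0 \<le> x \<and> x \<le> 1 \<and> 0 \<le> t"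
  by (auto simp: Pi_strip_def)

text \<open>
  Weight the energy by \<open>exp (- l y)\<close>, where \<open>y\<close> is the distance from the inflow end. With zero
  inflow the boundary flux has a favourable sign, and the bulk term decays at rate \<open>l * a0 - 3 * A\<close>.
  Comparison with the unweighted energy costs at most \<open>exp l\<close>. So the energy at time \<open>t\<close> is
  at most a constant times \<open>exp (- l (a0 (t - t0) - 1))\<close>, which tends to zero with
  \<open>l\<close> tending to infinity as soon as the crossing time \<open>1 / a0\<close> has passed.
\<close>

lemma zero_inflow_extinction:
  assumes sb: "speed_bounds n m a b a0 A ax at'" and "m \<le> n" and j: "j \<in> {1..n}"
    and u: "transports (a j) (b j) u ux ut" and t0: "t0 \<ge> 0"
    and inflow: "\<And>t. t \<ge> t0 \<Longrightarrow> (if j \<le> m then u (0, t) else u (1, t)) = 0"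
    and t: "t > t0 + 1 / a0" and x: "x \<in> {0..1}"
  shows "u (x, t) = 0"
proof -
  have a0: "a0 > 0" and aC: "C1_with_partials (a j) (ax j) (at' j)" and bC: "continuous_on Pi_strip (b j)"
    and bd: "\<And>z. z \<in> Pi_strip \<Longrightarrow> \<bar>a j z\<bar> \<le> A \<and> \<bar>ax j z\<bar> \<le> A \<and> \<bar>b j z\<bar> \<le> A"
    using sb j unfolding speed_bounds_def by blast+
  have sgn: "if j \<le> m then a j z \<ge> a0 else a j z \<le> - a0" if "z \<in> Pi_strip" for z
    using sb j that unfolding speed_bounds_def by auto
  have uC: "C1_with_partials u ux ut" using u by (simp add: transports_def)
  note cu = C1_with_partials_continuous(1)[OF uC]
  have tt0: "t > t0" and t_pos: "t > 0" using t t0 a0 by (auto simp: add_strict_increasing2 intro: order_le_less_trans[rotated])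
  let ?I = "energy 0 0 u"
  let ?\<delta> = "a0 * (t - t0) - 1"
  have \<delta>: "?\<delta> > 0" using t a0 by (simp add: field_simps)
  have est: "?I t \<le> exp (3 * A * (t - t0)) * ?I t0 * exp (- ?\<delta> * l)" if l: "l > 0" for l
  proof -
    \<comment> \<open>the weight \<open>exp (k + c x)\<close> is \<open>1\<close> at the inflow end and \<open>exp (- l)\<close> at the outflow end\<close>
    define k where "k = (if j \<le> m then 0 else - l)"
    define c where "c = (if j \<le> m then - l else l)"
    define E' where "E' s = exp k * (a j (0, s) * (u (0, s))\<^sup>2) - exp (k + c) * (a j (1, s) * (u (1, s))\<^sup>2)
      + integral {0..1} (\<lambda>x. (c * a j (x, s) + ax j (x, s) - 2 * b j (x, s)) * (exp (k + c * x) * (u (x, s))\<^sup>2))" for s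
    have "energy k c u t \<le> exp ((3 * A - l * a0) * (t - t0)) * energy k c u t0"
    proof (rule gronwall[where E' = E'])
      show "continuous_on {t0..} (energy k c u)"
        by (rule continuous_on_subset[OF energy_continuous[OF uC]]) (use t0 in auto)
    next
      fix s assume s: "s > t0"
      then show "(energy k c u has_real_derivative E' s) (at s)"
        unfolding E'_def using t0 by (intro energy_derivative[OF u aC bC]) auto
      have bdry: "exp k * (a j (0, s) * (u (0, s))\<^sup>2) - exp (k + c) * (a j (1, s) * (u (1, s))\<^sup>2) \<le> 0"
      proof (cases "j \<le> m")
        case True
        then show ?thesis using inflow[of s] sgn[of "(1, s)"] s t0 a0 by simp
      next
        case False
        then show ?thesis using inflow[of s] sgn[of "(0, s)"] s t0 a0 by (simp add: mult_nonpos_nonneg mult_nonneg_nonpos)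
      qed
      have "integral {0..1} (\<lambda>x. (c * a j (x, s) + ax j (x, s) - 2 * b j (x, s)) * (exp (k + c * x) * (u (x, s))\<^sup>2))
          \<le> (3 * A - l * a0) * energy k c u s"
      proof (rule energy_mono_weight[OF cu])
        show "continuous_on {0..1} (\<lambda>x. c * a j (x, s) + ax j (x, s) - 2 * b j (x, s))"
          using s t0 by (intro continuous_intros continuous_on_strip_x[of _ s]
            C1_with_partials_continuous[OF aC] bC) auto
        fix x :: real assume "x \<in> {0..1}"
        then have z: "(x, s) \<in> Pi_strip" using s t0 by simp
        have "c * a j (x, s) \<le> - (l * a0)"
          using sgn[OF z] l mult_left_mono[of a0 "a j (x, s)" l] mult_left_mono[of "a j (x, s)" "- a0" l]
          by (cases "j \<le> m") (auto simp: c_def)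
        then show "c * a j (x, s) + ax j (x, s) - 2 * b j (x, s) \<le> 3 * A - l * a0"
          using bd[OF z] by linarith
      qed (use s t0 in auto)
      then show "E' s \<le> (3 * A - l * a0) * energy k c u s"
        using bdry unfolding E'_def by linarith
    qed (use tt0 in auto)
    also have "\<dots> \<le> exp ((3 * A - l * a0) * (t - t0)) * ?I t0"
      by (intro mult_left_mono energy_le[OF cu t0]) (use l in \<open>auto simp: k_def c_def mult_le_cancel_left1\<close>)
    finally have 1: "energy k c u t \<le> exp ((3 * A - l * a0) * (t - t0)) * ?I t0" .
    have "exp (- l) * ?I t = energy (- l) 0 u t"
      by (simp add: energy_def)
    also have "\<dots> \<le> energy k c u t"
      by (intro energy_le[OF cu]) (use l t_pos in \<open>auto simp: k_def c_def mult_le_cancel_left1\<close>)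
    finally have "exp l * (exp (- l) * ?I t) \<le> exp l * (exp ((3 * A - l * a0) * (t - t0)) * ?I t0)"
      using 1 by (intro mult_left_mono) auto
    then have "?I t \<le> exp (l + (3 * A - l * a0) * (t - t0)) * ?I t0"
      by (simp only: mult.assoc[symmetric] exp_add[symmetric]) simp
    also have "l + (3 * A - l * a0) * (t - t0) = 3 * A * (t - t0) + (- ?\<delta> * l)"
      by (simp add: algebra_simps)
    finally show ?thesis by (simp only: exp_add mult_ac)
  qed
  have "((\<lambda>l. exp (3 * A * (t - t0)) * ?I t0 * exp (- ?\<delta> * l)) \<longlongrightarrow> exp (3 * A * (t - t0)) * ?I t0 * 0) at_top"
  proof (intro tendsto_mult tendsto_const filterlim_compose[OF exp_at_bot])
    show "LIM l at_top. - ?\<delta> * l :> at_bot"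
      by (rule filterlim_tendsto_neg_mult_at_bot[OF tendsto_const _ filterlim_ident]) (use \<delta> in auto)
  qed
  then have "?I t \<le> exp (3 * A * (t - t0)) * ?I t0 * 0"
    by (rule tendsto_lowerbound[OF _ eventually_mono[OF eventually_gt_at_top[of 0] est]]) simp_all
  then have "integral {0..1} (\<lambda>x. (u (x, t))\<^sup>2) \<le> 0" by (simp add: energy_def)
  moreover have "integral {0..1} (\<lambda>x. (u (x, t))\<^sup>2) \<ge> 0" by (rule integral_nonneg) (use energy_integrable[OF cu, of t 0 0] t_pos in auto)
  ultimately have "integral {0..1} (\<lambda>x. (u (x, t))\<^sup>2) = 0" by simp
  then have "\<forall>x\<in>{0..1}. (u (x, t))\<^sup>2 = 0"
    using t_pos by (subst (asm) integral_eq_0_iff) (auto intro!: continuous_intros continuous_on_strip_x[OF cu])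
  then show ?thesis using x by auto
qed

section \<open>Stability, and extinction for acyclic graphs\<close>

text \<open>
  The two sums of the boundary condition run over the two directions of travel; both read off each
  component at the end where it leaves the interval.
\<close>

lemma boundary_value_outflow:
  assumes "m \<le> n"
  shows "boundary_value n m p u j t = (\<Sum>k=1..n. p j k * (if k \<le> m then u k (1, t) else u k (0, t)))"
proof -
  have "{1..n} = {1..m} \<union> {m+1..n}" using assms by auto
  then have "(\<Sum>k=1..n. p j k * (if k \<le> m then u k (1, t) else u k (0, t)))
    = (\<Sum>k=1..m. p j k * (if k \<le> m then u k (1, t) else u k (0, t)))
    + (\<Sum>k=m+1..n. p j k * (if k \<le> m then u k (1, t) else u k (0, t)))"
    by (simp only:) (rule sum.union_disjoint, auto)
  also have "(\<Sum>k=1..m. p j k * (if k \<le> m then u k (1, t) else u k (0, t))) = (\<Sum>k=1..m. p j k * u k (1, t))"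
    by (rule sum.cong) auto
  also have "(\<Sum>k=m+1..n. p j k * (if k \<le> m then u k (1, t) else u k (0, t))) = (\<Sum>k=m+1..n. p j k * u k (0, t))"
    by (rule sum.cong) auto
  finally show ?thesis by (simp only: boundary_value_def)
qed

lemma boundary_value_le:
  assumes "m \<le> n" and j: "j \<in> {1..n}"
  shows "(boundary_value n m p u j t)\<^sup>2
    \<le> (\<Sum>k=1..n. (p j k)\<^sup>2) * (\<Sum>k=1..n. (if k \<le> m then u k (1, t) else u k (0, t))\<^sup>2)"
  unfolding boundary_value_outflow[OF \<open>m \<le> n\<close>] by (rule Cauchy_Schwarz_ineq_sum)

text \<open>
  Weight each energy so that it is \<open>1\<close> at the inflow end and \<open>exp l\<close> at the outflow end. The
  inflow flux is bounded by the outflow values through the Cauchy-Schwarz inequality, and for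
  \<open>l\<close> large the weighted outflow flux dominates it. So the total flux is nonpositive and the
  Gronwall inequality applies.
\<close>

lemma classical_stability:
  assumes sb: "speed_bounds n m a b a0 A ax at'" and mn: "m \<le> n"
  obtains C K where "C \<ge> 0" "K \<ge> 0"
    "\<And>\<phi> u t. classical_solution n m p a b \<phi> u \<Longrightarrow> t \<ge> 0 \<Longrightarrow>
       (\<Sum>j=1..n. energy 0 0 (u j) t) \<le> C * exp (K * t) * (\<Sum>j=1..n. energy 0 0 (u j) 0)"
proof -
  have a0: "a0 > 0" and A0: "A \<ge> 0" using sb by (auto simp: speed_bounds_def)
  define Q where "Q = (\<Sum>j=1..n. \<Sum>k=1..n. (p j k)\<^sup>2)"
  \<comment> \<open>any \<open>l\<close> with \<open>A * Q \<le> exp l * a0\<close> would do, and \<open>l \<le> exp l\<close>\<close>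
  define l where "l = A * Q / a0"
  have Q0: "Q \<ge> 0" unfolding Q_def by (intro sum_nonneg) auto
  have l0: "l \<ge> 0" unfolding l_def using a0 A0 Q0 by simp
  have "A * Q = l * a0" using a0 by (simp add: l_def)
  also have "\<dots> \<le> exp l * a0"
    using exp_ge_add_one_self[of l] a0 by (intro mult_right_mono) linarith+
  finally have AQ: "A * Q \<le> exp l * a0" .
  define K where "K = l * A + 3 * A"
  define k where "k j = (if j \<le> m then 0 else l)" for j
  define c where "c j = (if j \<le> m then l else - l)" for j
  have "(\<Sum>j=1..n. energy 0 0 (u j) t) \<le> exp l * exp (K * t) * (\<Sum>j=1..n. energy 0 0 (u j) 0)"
    if cs: "classical_solution n m p a b \<phi> u" and t: "t \<ge> 0" for \<phi> u t
  proof -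
    have "\<forall>j\<in>{1..n}. \<exists>ux ut. transports (a j) (b j) (u j) ux ut"
      using classical_solution_transports[OF cs] by blast
    then obtain ux ut where tr: "\<And>j. j \<in> {1..n} \<Longrightarrow> transports (a j) (b j) (u j) (ux j) (ut j)"
      by metis
    have uC: "C1_with_partials (u j) (ux j) (ut j)" if "j \<in> {1..n}" for j
      using tr[OF that] by (simp add: transports_def)
    note cu = C1_with_partials_continuous(1)[OF uC]
    define B where "B j s = exp (k j) * (a j (0, s) * (u j (0, s))\<^sup>2) - exp (k j + c j) * (a j (1, s) * (u j (1, s))\<^sup>2)" for j s
    define R where "R j s = integral {0..1} (\<lambda>x. (c j * a j (x, s) + ax j (x, s) - 2 * b j (x, s))
        * (exp (k j + c j * x) * (u j (x, s))\<^sup>2))" for j s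
    define out where "out j s = (if j \<le> m then u j (1, s) else u j (0, s))" for j s
    let ?E = "\<lambda>s. \<Sum>j=1..n. energy (k j) (c j) (u j) s"
    have "?E t \<le> exp (K * (t - 0)) * ?E 0"
    proof (rule gronwall[where E' = "\<lambda>s. \<Sum>j=1..n. B j s + R j s"])
      show "continuous_on {0..} ?E"
        by (intro continuous_on_sum energy_continuous[OF uC])
    next
      fix s :: real assume s: "s > 0"
      show "(?E has_real_derivative (\<Sum>j=1..n. B j s + R j s)) (at s)"
      proof (rule DERIV_sum)
        fix j assume j: "j \<in> {1..n}"
        then have aC: "C1_with_partials (a j) (ax j) (at' j)" and bC: "continuous_on Pi_strip (b j)"
          using sb by (auto simp: speed_bounds_def)
        show "(energy (k j) (c j) (u j) has_real_derivative B j s + R j s) (at s)"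
          unfolding B_def R_def by (rule energy_derivative[OF tr[OF j] aC bC s])
      qed
      have R: "R j s \<le> K * energy (k j) (c j) (u j) s" if j: "j \<in> {1..n}" for j
        unfolding R_def
      proof (rule energy_mono_weight[OF cu[OF j]])
        have aC: "C1_with_partials (a j) (ax j) (at' j)" and bC: "continuous_on Pi_strip (b j)"
          using sb j by (auto simp: speed_bounds_def)
        show "continuous_on {0..1} (\<lambda>x. c j * a j (x, s) + ax j (x, s) - 2 * b j (x, s))"
          using s by (intro continuous_intros continuous_on_strip_x[of _ s]
            C1_with_partials_continuous[OF aC] bC) auto
        fix x :: real assume "x \<in> {0..1}"
        then have z: "(x, s) \<in> Pi_strip" using s by simp
        then have bd: "\<bar>a j (x, s)\<bar> \<le> A \<and> \<bar>ax j (x, s)\<bar> \<le> A \<and> \<bar>b j (x, s)\<bar> \<le> A"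
          using sb j unfolding speed_bounds_def by blast
        have "\<bar>c j * a j (x, s)\<bar> \<le> l * A"
          using bd l0 by (auto simp: c_def abs_mult intro: mult_left_mono)
        then show "c j * a j (x, s) + ax j (x, s) - 2 * b j (x, s) \<le> K"
          using bd unfolding K_def by linarith
      qed (use s in auto)
      have B: "B j s \<le> A * (boundary_value n m p u j s)\<^sup>2 - exp l * a0 * (out j s)\<^sup>2"
        if j: "j \<in> {1..n}" for j
      proof (cases "j \<le> m")
        case True
        have bd: "a j (0, s) \<le> A" "a j (1, s) \<ge> a0"
          using sb j s True unfolding speed_bounds_def by (auto simp: abs_le_iff)
        have bv: "u j (0, s) = boundary_value n m p u j s"
          using cs j True s unfolding classical_solution_def by auto
        have "B j s = a j (0, s) * (u j (0, s))\<^sup>2 - exp l * a j (1, s) * (out j s)\<^sup>2"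
          using True by (simp add: B_def k_def c_def out_def)
        also have "\<dots> \<le> A * (u j (0, s))\<^sup>2 - exp l * a0 * (out j s)\<^sup>2"
          using bd by (intro diff_mono mult_right_mono mult_left_mono) auto
        finally show ?thesis by (simp only: bv)
      next
        case False
        then have jm: "j \<in> {m+1..n}" using j by auto
        have "\<bar>a j (1, s)\<bar> \<le> A" "a j (0, s) \<le> - a0"
          using sb j s jm unfolding speed_bounds_def by auto
        then have bd: "- a j (1, s) \<le> A" "- a j (0, s) \<ge> a0" by linarith+
        have bv: "u j (1, s) = boundary_value n m p u j s"
          using cs jm s unfolding classical_solution_def by auto
        have "B j s = (- a j (1, s)) * (u j (1, s))\<^sup>2 - exp l * (- a j (0, s)) * (out j s)\<^sup>2"
          using False by (simp add: B_def k_def c_def out_def)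
        also have "\<dots> \<le> A * (u j (1, s))\<^sup>2 - exp l * a0 * (out j s)\<^sup>2"
          using bd by (intro diff_mono mult_right_mono mult_left_mono) auto
        finally show ?thesis by (simp only: bv)
      qed
      let ?O = "\<Sum>k=1..n. (out k s)\<^sup>2"
      have "(\<Sum>j=1..n. B j s) \<le> (\<Sum>j=1..n. A * ((\<Sum>k=1..n. (p j k)\<^sup>2) * ?O) - exp l * a0 * (out j s)\<^sup>2)"
      proof (rule sum_mono)
        fix j assume j: "j \<in> {1..n}"
        have "(boundary_value n m p u j s)\<^sup>2 \<le> (\<Sum>k=1..n. (p j k)\<^sup>2) * ?O"
          using boundary_value_le[OF mn j] by (simp only: out_def)
        then show "B j s \<le> A * ((\<Sum>k=1..n. (p j k)\<^sup>2) * ?O) - exp l * a0 * (out j s)\<^sup>2"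
          using B[OF j] mult_left_mono[OF _ A0] by fastforce
      qed
      also have "\<dots> = A * (Q * ?O) - exp l * a0 * ?O"
        unfolding Q_def by (simp only: sum_subtractf sum_distrib_left[symmetric] sum_distrib_right[symmetric])
      also have "\<dots> = (A * Q - exp l * a0) * ?O"
        by (simp only: left_diff_distrib mult.assoc)
      also have "\<dots> \<le> 0"
        using AQ by (intro mult_nonpos_nonneg sum_nonneg) auto
      finally have "(\<Sum>j=1..n. B j s) \<le> 0" .
      moreover have "(\<Sum>j=1..n. R j s) \<le> K * ?E s"
        unfolding sum_distrib_left by (rule sum_mono) (rule R)
      ultimately show "(\<Sum>j=1..n. B j s + R j s) \<le> K * ?E s"
        by (simp add: sum.distrib)
    qed (use t in auto)
    also have "?E 0 \<le> exp l * (\<Sum>j=1..n. energy 0 0 (u j) 0)"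
      unfolding sum_distrib_left
    proof (rule sum_mono)
      fix j assume j: "j \<in> {1..n}"
      have "energy (k j) (c j) (u j) 0 \<le> energy l 0 (u j) 0"
        by (rule energy_le[OF cu[OF j]]) (use l0 in \<open>auto simp: k_def c_def mult_left_le\<close>)
      then show "energy (k j) (c j) (u j) 0 \<le> exp l * energy 0 0 (u j) 0"
        by (simp add: energy_def)
    qed
    finally have "?E t \<le> exp (K * t) * (exp l * (\<Sum>j=1..n. energy 0 0 (u j) 0))" by simp
    moreover have "(\<Sum>j=1..n. energy 0 0 (u j) t) \<le> ?E t"
    proof (rule sum_mono)
      fix j assume j: "j \<in> {1..n}"
      show "energy 0 0 (u j) t \<le> energy (k j) (c j) (u j) t"
        by (rule energy_le[OF cu[OF j] t]) (use l0 in \<open>auto simp: k_def c_def mult_left_le\<close>)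
    qed
    ultimately show ?thesis by (simp add: mult_ac)
  qed
  moreover have "K \<ge> 0" unfolding K_def using l0 A0 by simp
  ultimately show ?thesis using that[of "exp l" K] by auto
qed

text \<open>
  The extinction time must not depend on the solution, so a component counts as dead only if one time
  works for all solutions. If some component were not dead, acyclicity would provide a component that
  is not dead but is fed only by dead ones; its inflow is zero from some time on, so it dies as well.
\<close>

lemma acyclic_extinction:
  assumes sb: "speed_bounds n m a b a0 A ax at'" and mn: "m \<le> n"
    and ac: "acyclic_digraph {1..n} (G_arrows n p)"
  obtains T where "T > 0" "\<And>\<phi> u j t x. classical_solution n m p a b \<phi> u \<Longrightarrow> j \<in> {1..n} \<Longrightarrow> t > T
    \<Longrightarrow> x \<in> {0..1} \<Longrightarrow> u j (x, t) = 0"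
proof -
  have a0: "a0 > 0" using sb by (auto simp: speed_bounds_def)
  define dead where "dead j T \<longleftrightarrow> (\<forall>\<phi> u t x. classical_solution n m p a b \<phi> u \<longrightarrow> t > T \<longrightarrow>
    x \<in> {0..1} \<longrightarrow> u j (x, t) = 0)" for j T
  define S where "S = {j \<in> {1..n}. \<nexists>T. dead j T}"
  have "\<forall>j. \<exists>T. j \<in> {1..n} \<and> j \<notin> S \<longrightarrow> dead j T" by (auto simp: S_def)
  then obtain \<tau> where \<tau>: "\<And>j. j \<in> {1..n} \<Longrightarrow> j \<notin> S \<Longrightarrow> dead j (\<tau> j)" by metis
  \<comment> \<open>the summand \<open>1\<close> makes \<open>T0\<close> positive and strictly larger than every \<open>\<tau> j\<close>\<close>
  define T0 where "T0 = (\<Sum>j=1..n. \<bar>\<tau> j\<bar>) + 1"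
  have T0: "T0 > \<tau> j" if "j \<in> {1..n}" for j
    using member_le_sum[of j "{1..n}" "\<lambda>j. \<bar>\<tau> j\<bar>"] that by (auto simp: T0_def)
  have T0_pos: "T0 > 0" unfolding T0_def by (intro add_nonneg_pos sum_nonneg) auto
  have "S = {}"
  proof (rule ccontr)
    assume "S \<noteq> {}"
    moreover have "S \<subseteq> {1..n}" by (auto simp: S_def)
    ultimately obtain j where j: "j \<in> S" "\<forall>k\<in>S. (j, k) \<notin> G_arrows n p"
      using ac unfolding acyclic_digraph_iff[OF finite_atLeastAtMost] by meson
    have jn: "j \<in> {1..n}" using j by (auto simp: S_def)
    have "dead j (T0 + 1 / a0)"
      unfolding dead_def
    proof (intro allI impI)
      fix \<phi> u t and x :: real assume cs: "classical_solution n m p a b \<phi> u" and t: "t > T0 + 1 / a0" and x: "x \<in> {0..1}"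
      obtain ux ut where tr: "transports (a j) (b j) (u j) ux ut"
        using classical_solution_transports[OF cs jn] by blast
      have bv: "boundary_value n m p u j s = 0" if s: "s \<ge> T0" for s
        unfolding boundary_value_outflow[OF mn]
      proof (rule sum.neutral, rule ballI)
        fix k assume k: "k \<in> {1..n}"
        show "p j k * (if k \<le> m then u k (1, s) else u k (0, s)) = 0"
        proof (cases "k \<in> S")
          case True
          then show ?thesis using j(2) jn k by (auto simp: G_arrows_def)
        next
          case False
          have "s > \<tau> k" using T0[OF k] s by simp
          then have "u k (x, s) = 0" if "x \<in> {0..1}" for x
            using \<tau>[OF k False] cs that unfolding dead_def by blast
          then show ?thesis by simp
        qed
      qed
      show "u j (x, t) = 0"
      proof (rule zero_inflow_extinction[OF sb mn jn tr _ _ t x])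
        fix s assume s: "s \<ge> T0"
        then show "(if j \<le> m then u j (0, s) else u j (1, s)) = 0"
          using cs jn bv[OF s] T0_pos unfolding classical_solution_def by auto
      qed (use T0_pos in auto)
    qed
    then show False using j(1) by (auto simp: S_def)
  qed
  then have "u j (x, t) = 0" if "classical_solution n m p a b \<phi> u" "j \<in> {1..n}" "t > T0" "x \<in> {0..1}" for \<phi> u j t x
    using \<tau>[OF that(2)] T0[OF that(2)] that unfolding dead_def by (metis empty_iff order_less_trans)
  then show ?thesis using that T0_pos by blast
qed

section \<open>Generalized solutions as limits of classical ones\<close>

lemma norm_L2_cong:
  assumes "\<And>x. 0 < x \<Longrightarrow> x < 1 \<Longrightarrow> f x = g x"
  shows "norm_L2 f = norm_L2 g"
  unfolding norm_L2_def
  by (intro arg_cong[where f = sqrt] Bochner_Integration.integral_cong) (auto simp: assms)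

lemma in_L2_cong:
  assumes "\<And>x. 0 < x \<Longrightarrow> x < 1 \<Longrightarrow> f x = g x"
  shows "in_L2 f \<longleftrightarrow> in_L2 g"
proof -
  have "f \<in> borel_measurable (lebesgue_on {0<..<1}) \<longleftrightarrow> g \<in> borel_measurable (lebesgue_on {0<..<1})"
    by (rule measurable_cong) (auto simp: assms)
  moreover have "integrable (lebesgue_on {0<..<1}) (\<lambda>x. (f x)\<^sup>2) \<longleftrightarrow> integrable (lebesgue_on {0<..<1}) (\<lambda>x. (g x)\<^sup>2)"
    by (rule Bochner_Integration.integrable_cong) (auto simp: assms)
  ultimately show ?thesis by (simp add: in_L2_def)
qed

lemma norm_L2_eq_0_imp_AE:
  assumes "in_L2 f" "norm_L2 f = 0"
  shows "AE x in lebesgue_on {0<..<1}. f x = 0"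
proof -
  have "integrable (lebesgue_on {0<..<1}) (\<lambda>x. (f x)\<^sup>2)" using assms(1) by (simp add: in_L2_def)
  then have "AE x in lebesgue_on {0<..<1}. (f x)\<^sup>2 = 0"
    using assms(2) by (subst integral_nonneg_eq_0_iff_AE[symmetric]) (auto simp: norm_L2_def)
  then show ?thesis by simp
qed

lemma norm_L2n_le_iff:
  assumes "n \<ge> 1"
  shows "norm_L2n n f \<le> r \<longleftrightarrow> (\<forall>j\<in>{1..n}. norm_L2 (f j) \<le> r)"
  unfolding norm_L2n_def using assms by (subst Max_le_iff) auto

lemma norm_L2n_nonneg:
  assumes "n \<ge> 1"
  shows "norm_L2n n f \<ge> 0"
  using norm_L2n_le_iff[OF assms, of f "norm_L2n n f"] norm_L2_nonneg[of "f 1"] assms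
  by (meson atLeastAtMost_iff order_refl order_trans)

text \<open>
  A sum of squares instead of the maximum of norms, since the energies add up.
\<close>

definition initial_error :: "nat \<Rightarrow> (nat \<Rightarrow> real \<Rightarrow> real) \<Rightarrow> (nat \<Rightarrow> real \<Rightarrow> real) \<Rightarrow> real" where
  "initial_error n \<phi> \<psi> = (\<Sum>j=1..n. (norm_L2 (\<lambda>x. \<phi> j x - \<psi> j x))\<^sup>2)"

lemma initial_error_nonneg: "initial_error n \<phi> \<psi> \<ge> 0"
  unfolding initial_error_def by (intro sum_nonneg) simp

lemma initial_error_tendsto_0:
  assumes n: "n \<ge> 1" and lim: "(\<lambda>l. norm_L2n n (\<lambda>j x. \<phi>l l j x - \<phi> j x)) \<longlonglongrightarrow> 0"
  shows "(\<lambda>l. initial_error n (\<phi>l l) \<phi>) \<longlonglongrightarrow> 0"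
proof -
  let ?d = "\<lambda>l. norm_L2n n (\<lambda>j x. \<phi>l l j x - \<phi> j x)"
  have lim2: "(\<lambda>l. real n * (?d l)\<^sup>2) \<longlonglongrightarrow> 0"
    using tendsto_mult[OF tendsto_const[of "real n"] tendsto_power[OF lim, of 2]] by simp
  have "initial_error n (\<phi>l l) \<phi> \<le> real n * (?d l)\<^sup>2" for l
  proof -
    have "(norm_L2 (\<lambda>x. \<phi>l l j x - \<phi> j x))\<^sup>2 \<le> (?d l)\<^sup>2" if "j \<in> {1..n}" for j
      using norm_L2n_le_iff[OF n, of "\<lambda>j x. \<phi>l l j x - \<phi> j x" "?d l"] that by (intro power_mono) auto
    from sum_mono[OF this, of "{1..n}"] show ?thesis by (simp add: initial_error_def)
  qed
  then show ?thesis
    by (intro tendsto_sandwich[OF _ _ tendsto_const lim2]) (auto simp: initial_error_nonneg)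
qed

lemma initial_error_triangle:
  assumes "\<And>j. j \<in> {1..n} \<Longrightarrow> in_L2 (\<phi> j) \<and> in_L2 (\<psi> j) \<and> in_L2 (\<omega> j)"
  shows "initial_error n \<phi> \<psi> \<le> 2 * initial_error n \<phi> \<omega> + 2 * initial_error n \<psi> \<omega>"
  unfolding initial_error_def sum_distrib_left sum.distrib[symmetric]
  by (intro sum_mono norm_L2_triangle) (use assms in auto)

text \<open>
  Time continuity of the generalized solution is inherited from the classical ones by uniform
  convergence on bounded time intervals.
\<close>

lemma continuous_on_L2_time:
  assumes u: "continuous_on Pi_strip u" and t: "t \<ge> 0"
  shows "((\<lambda>s. (norm_L2 (\<lambda>x. u (x, s) - u (x, t)))\<^sup>2) \<longlongrightarrow> 0) (at t within {0..})"
proof -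
  have "continuous_on {0..} (\<lambda>s. integral (cbox 0 1) (\<lambda>x. (u (x, s) - u (x, t))\<^sup>2))"
  proof (rule integral_continuous_on_param)
    have "continuous_on ({0..} \<times> cbox 0 1) (\<lambda>z. u (snd z, fst z))"
      by (rule continuous_on_compose2[OF u]) (auto intro!: continuous_intros)
    moreover have "continuous_on ({0..} \<times> cbox (0::real) 1) (\<lambda>z. u (snd z, t))"
      by (rule continuous_on_compose2[OF u]) (use t in \<open>auto intro!: continuous_intros\<close>)
    ultimately show "continuous_on ({0..} \<times> cbox 0 1) (\<lambda>(s, x). (u (x, s) - u (x, t))\<^sup>2)"
      unfolding case_prod_beta by (intro continuous_intros)
  qed
  then have "((\<lambda>s. integral {0..1} (\<lambda>x. (u (x, s) - u (x, t))\<^sup>2)) \<longlongrightarrow> 0) (at t within {0..})"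
    using t unfolding continuous_on_def by (auto dest!: bspec[of _ _ t])
  moreover have "\<forall>\<^sub>F s in at t within {0..}. integral {0..1} (\<lambda>x. (u (x, s) - u (x, t))\<^sup>2)
      = (norm_L2 (\<lambda>x. u (x, s) - u (x, t)))\<^sup>2"
    unfolding eventually_at_filter
  proof (intro always_eventually allI impI)
    fix s :: real assume "s \<in> {0..}"
    then show "integral {0..1} (\<lambda>x. (u (x, s) - u (x, t))\<^sup>2) = (norm_L2 (\<lambda>x. u (x, s) - u (x, t)))\<^sup>2"
      using t by (intro in_L2_continuous(2)[symmetric] continuous_intros continuous_on_strip_x[OF u]) auto
  qed
  ultimately show ?thesis by (simp add: tendsto_cong)
qed

text \<open>
  The second property transfers extinction: whenever every classical solution has a vanishing
  component at some time, so has the generalized solution. It is part of this lemma because it comes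
  from the approximating classical solutions, which the conclusion no longer shows.

  The limit is built from one sequence of classical solutions with converging data. Stability makes
  it independent of the sequence. If no sequence exists, the zero function qualifies.
\<close>

lemma generalized_solution_exists:
  assumes n: "n \<ge> 1" and "C \<ge> 0" "K \<ge> 0"
    and stab: "\<And>\<phi> u t. classical_solution n m p a b \<phi> u \<Longrightarrow> t \<ge> 0 \<Longrightarrow>
       (\<Sum>j=1..n. energy 0 0 (u j) t) \<le> C * exp (K * t) * (\<Sum>j=1..n. energy 0 0 (u j) 0)"
    and \<phi>: "\<And>j. j \<in> {1..n} \<Longrightarrow> in_L2 (\<phi> j)"
  obtains u where "L2_generalized_solution n m p a b \<phi> u"
    "\<And>t j. t \<ge> 0 \<Longrightarrow> j \<in> {1..n} \<Longrightarrow>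
       (\<And>\<psi> v x. classical_solution n m p a b \<psi> v \<Longrightarrow> x \<in> {0..1} \<Longrightarrow> v j (x, t) = 0) \<Longrightarrow>
       AE x in lebesgue_on {0<..<1}. u j t x = 0"
proof -
  define approx where "approx \<phi>l U \<longleftrightarrow> (\<forall>l. \<forall>j\<in>{1..n}. C0_inf (\<phi>l l j)) \<and>
        (\<lambda>l. norm_L2n n (\<lambda>j x. \<phi>l l j x - \<phi> j x)) \<longlonglongrightarrow> 0 \<and>
        (\<forall>l. classical_solution n m p a b (\<phi>l l) (U l))" for \<phi>l U
  show ?thesis
  proof (cases "\<exists>\<phi>l U. approx \<phi>l U")
    case False
    have "in_L2 (\<lambda>x. 0)" by (simp add: in_L2_def)
    moreover have "norm_L2 (\<lambda>x. 0) = 0" by (simp add: norm_L2_def)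
    ultimately have "L2_generalized_solution n m p a b \<phi> (\<lambda>j t x. 0)"
      using False unfolding L2_generalized_solution_def approx_def[symmetric] by simp
    then show ?thesis using that by auto
  next
    case True
    then obtain \<phi>l U where ap: "approx \<phi>l U" by blast
    have init_L2: "in_L2 (\<psi> j)" if "classical_solution n m p a b \<psi> v" "j \<in> {1..n}" for \<psi> v j
    proof -
      have "in_L2 (\<lambda>x. v j (x, 0))"
        by (intro in_L2_continuous continuous_on_strip_x classical_solution_continuous[OF that]) simp
      then show ?thesis
        using that by (subst (asm) in_L2_cong[where g = "\<psi> j"]) (auto simp: classical_solution_def)
    qed
    have diff: "(norm_L2 (\<lambda>x. v j (x, t) - w j (x, t)))\<^sup>2 \<le> C * exp (K * t) * initial_error n \<psi> \<omega>"
      if v: "classical_solution n m p a b \<psi> v" and w: "classical_solution n m p a b \<omega> w"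
        and j: "j \<in> {1..n}" and t: "t \<ge> 0" for \<psi> v \<omega> w j t
    proof -
      let ?d = "\<lambda>j z. v j z - w j z"
      have vw: "classical_solution n m p a b (\<lambda>j x. \<psi> j x - \<omega> j x) ?d"
        by (rule classical_solution_diff[OF v w])
      have en: "energy 0 0 (?d i) s = (norm_L2 (\<lambda>x. ?d i (x, s)))\<^sup>2" if "i \<in> {1..n}" "s \<ge> 0" for i s
        using in_L2_continuous(2)[OF continuous_on_strip_x[OF classical_solution_continuous[OF vw that(1)] that(2)]]
        by (simp add: energy_def)
      have "(norm_L2 (\<lambda>x. ?d j (x, t)))\<^sup>2 \<le> (\<Sum>i=1..n. energy 0 0 (?d i) t)"
        using member_le_sum[of j "{1..n}" "\<lambda>i. energy 0 0 (?d i) t"] en t j by auto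
      also have "\<dots> \<le> C * exp (K * t) * (\<Sum>i=1..n. energy 0 0 (?d i) 0)"
        by (rule stab[OF vw t])
      also have "(\<Sum>i=1..n. energy 0 0 (?d i) 0) = initial_error n \<psi> \<omega>"
        unfolding initial_error_def
      proof (rule sum.cong)
        fix i assume i: "i \<in> {1..n}"
        have "norm_L2 (\<lambda>x. ?d i (x, 0)) = norm_L2 (\<lambda>x. \<psi> i x - \<omega> i x)"
          using vw i by (intro norm_L2_cong) (auto simp: classical_solution_def)
        then show "energy 0 0 (?d i) 0 = (norm_L2 (\<lambda>x. \<psi> i x - \<omega> i x))\<^sup>2"
          using en[OF i] by simp
      qed simp
      finally show ?thesis by simp
    qed
    have cs: "classical_solution n m p a b (\<phi>l l) (U l)" for l using ap by (simp add: approx_def)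
    have UL2: "in_L2 (\<lambda>x. U l j (x, t))" if "j \<in> {1..n}" "t \<ge> 0" for l j t
      by (intro in_L2_continuous continuous_on_strip_x classical_solution_continuous[OF cs] that)
    define e where "e l = initial_error n (\<phi>l l) \<phi>" for l
    have e0: "e l \<ge> 0" for l by (simp add: e_def initial_error_nonneg)
    have e_lim: "e \<longlonglongrightarrow> 0"
      unfolding e_def using ap by (intro initial_error_tendsto_0[OF n]) (simp add: approx_def)
    have Udiff: "(norm_L2 (\<lambda>x. U k j (x, t) - U l j (x, t)))\<^sup>2 \<le> C * exp (K * t) * (2 * e k + 2 * e l)"
      if "j \<in> {1..n}" "t \<ge> 0" for k l j t
      unfolding e_def
      by (rule order_trans[OF diff[OF cs cs that] mult_left_mono[OF initial_error_triangle]])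
        (use init_L2[OF cs] \<phi> \<open>C \<ge> 0\<close> in auto)
    have "\<exists>g. in_L2 g \<and> (\<forall>l. (norm_L2 (\<lambda>x. g x - U l j (x, t)))\<^sup>2 \<le> 2 * (C * exp (K * t) * e l))"
      if jt: "j \<in> {1..n}" "t \<ge> 0" for j t
    proof -
      let ?c = "C * exp (K * t)"
      have c0: "?c \<ge> 0" using \<open>C \<ge> 0\<close> by simp
      have small: "\<exists>N. \<forall>k\<ge>N. e k \<le> r" if "r > 0" for r
        using order_tendstoD(2)[OF e_lim that] unfolding eventually_sequentially by (meson less_imp_le)
      have Cauchy: "\<exists>N. \<forall>k\<ge>N. \<forall>l\<ge>N. (norm_L2 (\<lambda>x. U k j (x, t) - U l j (x, t)))\<^sup>2 \<le> r" if r: "r > 0" for r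
      proof -
        have "((\<lambda>k. ?c * (4 * e k)) \<longlonglongrightarrow> ?c * (4 * 0))" by (intro tendsto_intros e_lim)
        then have "\<forall>\<^sub>F k in sequentially. ?c * (4 * e k) < r" by (rule order_tendstoD(2)) (use r in simp)
        then obtain N where N: "\<And>k. k \<ge> N \<Longrightarrow> ?c * (4 * e k) < r"
          unfolding eventually_sequentially by blast
        have "(norm_L2 (\<lambda>x. U k j (x, t) - U l j (x, t)))\<^sup>2 \<le> r" if "k \<ge> N" "l \<ge> N" for k l
        proof -
          have "2 * (norm_L2 (\<lambda>x. U k j (x, t) - U l j (x, t)))\<^sup>2 \<le> 2 * (?c * (2 * e k + 2 * e l))"
            using Udiff[OF jt, of k l] by (rule mult_left_mono) simp
          also have "\<dots> = ?c * (4 * e k) + ?c * (4 * e l)"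
            by (simp add: algebra_simps)
          also have "\<dots> < r + r" by (intro add_strict_mono N that)
          finally show ?thesis by simp
        qed
        then show ?thesis by blast
      qed
      obtain g where g: "in_L2 g" "\<And>r N l. (\<And>k. k \<ge> N \<Longrightarrow> (norm_L2 (\<lambda>x. U k j (x, t) - U l j (x, t)))\<^sup>2 \<le> r)
          \<Longrightarrow> (norm_L2 (\<lambda>x. g x - U l j (x, t)))\<^sup>2 \<le> r"
      proof (rule L2_complete[of "\<lambda>l x. U l j (x, t)", OF UL2[OF jt]])
        show "\<exists>N. \<forall>k\<ge>N. \<forall>l\<ge>N. (norm_L2 (\<lambda>x. U k j (x, t) - U l j (x, t)))\<^sup>2 \<le> r" if "r > 0" for r
          by (rule Cauchy[OF that])
      next
        fix g assume "in_L2 g" "\<And>r N l. (\<And>k. k \<ge> N \<Longrightarrow> (norm_L2 (\<lambda>x. U k j (x, t) - U l j (x, t)))\<^sup>2 \<le> r)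
          \<Longrightarrow> (norm_L2 (\<lambda>x. g x - U l j (x, t)))\<^sup>2 \<le> r"
        then show thesis by (rule that)
      qed
      have "(norm_L2 (\<lambda>x. g x - U l j (x, t)))\<^sup>2 \<le> 2 * (C * exp (K * t) * e l)" for l
      proof -
        have bd: "(norm_L2 (\<lambda>x. g x - U l j (x, t)))\<^sup>2 \<le> ?c * (2 * r + 2 * e l)" if r: "r > 0" for r
        proof -
          obtain N where N: "\<forall>k\<ge>N. e k \<le> r" using small[OF r] by blast
          show ?thesis
          proof (rule g(2)[of N])
            fix k assume "k \<ge> N"
            then have "?c * (2 * e k + 2 * e l) \<le> ?c * (2 * r + 2 * e l)"
              using N by (intro mult_left_mono[OF _ c0]) simp
            then show "(norm_L2 (\<lambda>x. U k j (x, t) - U l j (x, t)))\<^sup>2 \<le> ?c * (2 * r + 2 * e l)"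
              using Udiff[OF jt, of k l] by linarith
          qed
        qed
        \<comment> \<open>let the tail bound \<open>r\<close> tend to zero, so that only the error of the \<open>l\<close>-th data remains\<close>
        have "((\<lambda>r. ?c * (2 * r + 2 * e l)) \<longlongrightarrow> ?c * (2 * 0 + 2 * e l)) (at_right 0)"
          by (intro tendsto_intros)
        then have "(norm_L2 (\<lambda>x. g x - U l j (x, t)))\<^sup>2 \<le> ?c * (2 * 0 + 2 * e l)"
          by (rule tendsto_lowerbound[OF _ eventually_mono[OF eventually_at_right_less bd]]) simp_all
        then show ?thesis by (simp add: mult_ac)
      qed
      then show ?thesis using g(1) by blast
    qed
    then obtain u where uL2: "\<And>j t. j \<in> {1..n} \<Longrightarrow> t \<ge> 0 \<Longrightarrow> in_L2 (u j t)"
      and uU: "\<And>j t l. j \<in> {1..n} \<Longrightarrow> t \<ge> 0 \<Longrightarrow>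
        (norm_L2 (\<lambda>x. u j t x - U l j (x, t)))\<^sup>2 \<le> 2 * (C * exp (K * t) * e l)"
      by metis
    have mono: "C * exp (K * t) \<le> C * exp (K * T)" if "t \<le> T" for t T
      using that \<open>C \<ge> 0\<close> \<open>K \<ge> 0\<close> by (auto intro!: mult_left_mono)
    have cont: "((\<lambda>s. norm_L2 (\<lambda>x. u j s x - u j t x)) \<longlongrightarrow> 0) (at t within {0..})"
      if j: "j \<in> {1..n}" and t: "t \<ge> 0" for j t
    proof (rule tendstoI)
      fix r :: real assume r: "r > 0"
      let ?c = "C * exp (K * (t + 1))"
      have "(\<lambda>l. 12 * (?c * e l)) \<longlonglongrightarrow> 12 * (?c * 0)" by (intro tendsto_intros e_lim)
      then have "\<forall>\<^sub>F l in sequentially. 12 * (?c * e l) < r\<^sup>2 / 2" by (rule order_tendstoD(2)) (use r in simp)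
      then obtain l where l: "12 * (?c * e l) < r\<^sup>2 / 2" unfolding eventually_sequentially by blast
      define z where "z = ?c * e l"
      have z: "12 * z < r\<^sup>2 / 2" using l by (simp only: z_def)
      have "((\<lambda>s. (norm_L2 (\<lambda>x. U l j (x, s) - U l j (x, t)))\<^sup>2) \<longlongrightarrow> 0) (at t within {0..})"
        by (rule continuous_on_L2_time[OF classical_solution_continuous[OF cs j] t])
      then have "\<forall>\<^sub>F s in at t within {0..}. (norm_L2 (\<lambda>x. U l j (x, s) - U l j (x, t)))\<^sup>2 < r\<^sup>2 / 8"
        by (rule order_tendstoD(2)) (use r in simp)
      moreover have "\<forall>\<^sub>F s in at t within {0..}. s < t + 1"
        by (rule order_tendstoD(2)[OF tendsto_ident_at]) simp
      moreover have "\<forall>\<^sub>F s in at t within {0..}. s \<ge> 0"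
        unfolding eventually_at_filter by (intro always_eventually) simp
      ultimately show "\<forall>\<^sub>F s in at t within {0..}. dist (norm_L2 (\<lambda>x. u j s x - u j t x)) 0 < r"
      proof eventually_elim
        case (elim s)
        have 1: "(norm_L2 (\<lambda>x. u j s x - u j t x))\<^sup>2 \<le> 2 * (norm_L2 (\<lambda>x. u j s x - U l j (x, s)))\<^sup>2
            + 2 * (norm_L2 (\<lambda>x. u j t x - U l j (x, s)))\<^sup>2"
          by (intro norm_L2_triangle uL2 UL2 j t elim)
        have 2: "(norm_L2 (\<lambda>x. u j t x - U l j (x, s)))\<^sup>2 \<le> 2 * (norm_L2 (\<lambda>x. u j t x - U l j (x, t)))\<^sup>2
            + 2 * (norm_L2 (\<lambda>x. U l j (x, s) - U l j (x, t)))\<^sup>2"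
          by (intro norm_L2_triangle uL2 UL2 j t elim)
        have 3: "(norm_L2 (\<lambda>x. u j s x - U l j (x, s)))\<^sup>2 \<le> 2 * z"
          unfolding z_def
          by (rule order_trans[OF uU[OF j elim(3)] mult_left_mono[OF mult_right_mono[OF mono e0]]]) (use elim in simp_all)
        have 4: "(norm_L2 (\<lambda>x. u j t x - U l j (x, t)))\<^sup>2 \<le> 2 * z"
          unfolding z_def
          by (rule order_trans[OF uU[OF j t] mult_left_mono[OF mult_right_mono[OF mono e0]]]) simp_all
        have "(norm_L2 (\<lambda>x. u j s x - u j t x))\<^sup>2 < r\<^sup>2"
          using 1 2 3 4 elim(1) z by linarith
        then have "norm_L2 (\<lambda>x. u j s x - u j t x) < r"
          by (rule power_less_imp_less_base) (use r in simp)
        then show ?case by simp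
      qed
    qed
    have unif: "uniform_limit {0..T} (\<lambda>l t. norm_L2n n (\<lambda>j x. u j t x - V l j (x, t))) (\<lambda>t. 0) sequentially"
      if ap': "approx \<psi> V" for \<psi> V T
    proof (rule uniform_limitI)
      fix r :: real assume r: "r > 0"
      have cs': "classical_solution n m p a b (\<psi> l) (V l)" for l using ap' by (simp add: approx_def)
      define e' where "e' l = initial_error n (\<psi> l) \<phi>" for l
      have e0': "e' l \<ge> 0" for l by (simp add: e'_def initial_error_nonneg)
      have e_lim': "e' \<longlonglongrightarrow> 0"
        unfolding e'_def using ap' by (intro initial_error_tendsto_0[OF n]) (simp add: approx_def)
      let ?c = "C * exp (K * T)"
      have "(\<lambda>l. ?c * (8 * e l + 4 * e' l)) \<longlonglongrightarrow> ?c * (8 * 0 + 4 * 0)" by (intro tendsto_intros e_lim e_lim')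
      then have "\<forall>\<^sub>F l in sequentially. ?c * (8 * e l + 4 * e' l) < (r/2)\<^sup>2" by (rule order_tendstoD(2)) (use r in simp)
      then show "\<forall>\<^sub>F l in sequentially. \<forall>t\<in>{0..T}. dist (norm_L2n n (\<lambda>j x. u j t x - V l j (x, t))) 0 < r"
      proof eventually_elim
        case (elim l)
        show ?case
        proof
          fix t assume t: "t \<in> {0..T}"
          have "norm_L2n n (\<lambda>j x. u j t x - V l j (x, t)) \<le> r / 2"
            unfolding norm_L2n_le_iff[OF n]
          proof
            fix j assume j: "j \<in> {1..n}"
            have VL2: "in_L2 (\<lambda>x. V l j (x, t))"
              using t by (intro in_L2_continuous continuous_on_strip_x classical_solution_continuous[OF cs' j]) auto
            have t0: "t \<ge> 0" using t by simp
            have 1: "(norm_L2 (\<lambda>x. u j t x - V l j (x, t)))\<^sup>2 \<le> 2 * (norm_L2 (\<lambda>x. u j t x - U l j (x, t)))\<^sup>2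
              + 2 * (norm_L2 (\<lambda>x. V l j (x, t) - U l j (x, t)))\<^sup>2"
              by (rule norm_L2_triangle[OF uL2[OF j t0] VL2 UL2[OF j t0]])
            have 2: "(norm_L2 (\<lambda>x. V l j (x, t) - U l j (x, t)))\<^sup>2 \<le> C * exp (K * t) * (2 * e' l + 2 * e l)"
              unfolding e_def e'_def
              by (rule order_trans[OF diff[OF cs' cs j t0] mult_left_mono[OF initial_error_triangle]])
                (use init_L2[OF cs] init_L2[OF cs'] \<phi> \<open>C \<ge> 0\<close> in auto)
            have "(norm_L2 (\<lambda>x. u j t x - V l j (x, t)))\<^sup>2 \<le> C * exp (K * t) * (8 * e l + 4 * e' l)"
              using 1 2 uU[OF j t0, of l] by (simp add: algebra_simps)
            also have "\<dots> \<le> ?c * (8 * e l + 4 * e' l)"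
              using t e0[of l] e0'[of l] by (intro mult_right_mono mono) auto
            also have "\<dots> \<le> (r/2)\<^sup>2" using elim by simp
            finally show "norm_L2 (\<lambda>x. u j t x - V l j (x, t)) \<le> r / 2"
              by (rule power2_le_imp_le) (use r in simp)
          qed
          then show "dist (norm_L2n n (\<lambda>j x. u j t x - V l j (x, t))) 0 < r"
            using norm_L2n_nonneg[OF n, of "\<lambda>j x. u j t x - V l j (x, t)"] r by simp
        qed
      qed
    qed
    have "L2_generalized_solution n m p a b \<phi> u"
      unfolding L2_generalized_solution_def approx_def[symmetric] using uL2 cont unif by (intro conjI ballI allI impI) simp_all
    moreover have "AE x in lebesgue_on {0<..<1}. u j t x = 0"
      if t: "t \<ge> 0" and j: "j \<in> {1..n}" and
        van: "\<And>\<psi> v x. classical_solution n m p a b \<psi> v \<Longrightarrow> x \<in> {0..1} \<Longrightarrow> v j (x, t) = 0" for t j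
    proof (rule norm_L2_eq_0_imp_AE[OF uL2[OF j t]])
      have bd: "(norm_L2 (u j t))\<^sup>2 \<le> 2 * (C * exp (K * t) * e l)" for l
      proof -
        have "norm_L2 (u j t) = norm_L2 (\<lambda>x. u j t x - U l j (x, t))"
          by (rule norm_L2_cong) (use van[OF cs] in auto)
        then show ?thesis using uU[OF j t] by simp
      qed
      have lim: "(\<lambda>l. 2 * (C * exp (K * t) * e l)) \<longlonglongrightarrow> 2 * (C * exp (K * t) * 0)"
        by (intro tendsto_intros e_lim)
      have "(norm_L2 (u j t))\<^sup>2 \<le> 2 * (C * exp (K * t) * 0)"
        by (rule LIMSEQ_le_const[OF lim]) (use bd in blast)
      then show "norm_L2 (u j t) = 0" by simp
    qed
    ultimately show ?thesis by (rule that)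
  qed
qed

lemma acyclic_imp_FTS:
  assumes "n \<ge> 1" "m \<le> n" and ad: "admissible n m a b"
    and ac: "acyclic_digraph {1..n} (G_arrows n p)"
  shows "FTS n m p a b"
proof -
  obtain a0 A ax at' where sb: "speed_bounds n m a b a0 A ax at'"
    using admissible_speed_bounds[OF ad] by blast
  obtain C K where st: "C \<ge> 0" "K \<ge> 0"
    "\<And>\<phi> u t. classical_solution n m p a b \<phi> u \<Longrightarrow> t \<ge> 0 \<Longrightarrow>
       (\<Sum>j=1..n. energy 0 0 (u j) t) \<le> C * exp (K * t) * (\<Sum>j=1..n. energy 0 0 (u j) 0)"
    by (rule classical_stability[OF sb \<open>m \<le> n\<close>, of p]) (rule that)
  obtain T where T: "T > 0" "\<And>\<phi> u j t x. classical_solution n m p a b \<phi> u \<Longrightarrow> j \<in> {1..n} \<Longrightarrow> t > T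
    \<Longrightarrow> x \<in> {0..1} \<Longrightarrow> u j (x, t) = 0"
    by (rule acyclic_extinction[OF sb \<open>m \<le> n\<close> ac]) (rule that)
  show ?thesis
    unfolding FTS_def
  proof (intro exI[of _ T] conjI allI impI)
    fix \<phi> :: "nat \<Rightarrow> real \<Rightarrow> real" assume "\<forall>j\<in>{1..n}. in_L2 (\<phi> j)"
    then have \<phi>: "in_L2 (\<phi> j)" if "j \<in> {1..n}" for j using that by blast
    show "\<exists>u. L2_generalized_solution n m p a b \<phi> u \<and>
        (\<forall>t>T. \<forall>j\<in>{1..n}. AE x in lebesgue_on {0<..<1}. u j t x = 0)"
    proof (rule generalized_solution_exists[where \<phi> = \<phi> and n = n and m = m and p = p and a = a and b = b,
          OF \<open>n \<ge> 1\<close> st(1,2)])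
      fix u assume u: "L2_generalized_solution n m p a b \<phi> u"
        "\<And>t j. t \<ge> 0 \<Longrightarrow> j \<in> {1..n} \<Longrightarrow>
         (\<And>\<psi> v x. classical_solution n m p a b \<psi> v \<Longrightarrow> x \<in> {0..1} \<Longrightarrow> v j (x, t) = 0) \<Longrightarrow>
         AE x in lebesgue_on {0<..<1}. u j t x = 0"
      have "AE x in lebesgue_on {0<..<1}. u j t x = 0" if tj: "t > T" "j \<in> {1..n}" for t j
      proof (rule u(2)[OF _ tj(2)])
        show "v j (x, t) = 0" if "classical_solution n m p a b \<psi> v" "x \<in> {0..1}" for \<psi> v x
          by (rule T(2)[OF that(1) tj(2,1) that(2)])
      qed (use tj T(1) in simp)
      with u(1) show ?thesis by blast
    next
      show "(\<Sum>j=1..n. energy 0 0 (u j) t) \<le> C * exp (K * t) * (\<Sum>j=1..n. energy 0 0 (u j) 0)"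
        if "classical_solution n m p a b \<psi> u" "t \<ge> 0" for \<psi> u t
        by (rule st(3)[OF that])
    qed (rule \<phi>)
  qed (rule T(1))
qed

section \<open>Smooth bumps and bump trains\<close>

text \<open>
  The classical functions that are smooth but not analytic at \<open>0\<close>, such as \<open>exp (- 1 / x)\<close>
  for positive \<open>x\<close>. The polynomial factor in \<open>1 / x\<close> makes the family closed under
  differentiation.
\<close>

definition flat :: "real poly \<Rightarrow> real \<Rightarrow> real" where
  "flat q x = (if x > 0 then poly q (1 / x) * exp (- (1 / x)) else 0)"

lemma flat_tendsto_0: "(flat q \<longlongrightarrow> 0) (at 0)"
proof -
  have "((\<lambda>y. \<Sum>i\<le>degree q. coeff q i * (y ^ i / exp y)) \<longlongrightarrow> (\<Sum>i\<le>degree q. coeff q i * 0)) at_top"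
    by (intro tendsto_intros tendsto_power_div_exp_0)
  then have "((\<lambda>y. poly q y * exp (- y)) \<longlongrightarrow> 0) at_top"
    by (simp add: poly_altdef sum_distrib_right exp_minus divide_inverse mult.assoc)
  then have "((\<lambda>x. poly q (inverse x) * exp (- inverse x)) \<longlongrightarrow> 0) (at_right 0)"
    by (rule filterlim_compose) (rule filterlim_inverse_at_top_right)
  moreover have "\<forall>\<^sub>F x in at_right 0. poly q (inverse x) * exp (- inverse x) = flat q x"
    using eventually_at_right_less by eventually_elim (simp add: flat_def inverse_eq_divide)
  ultimately have "(flat q \<longlongrightarrow> 0) (at_right 0)"
    by (rule Lim_transform_eventually)
  moreover have "(flat q \<longlongrightarrow> 0) (at_left 0)"
    by (rule tendsto_eventually)
      (auto simp: flat_def eventually_at_filter intro!: always_eventually)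
  ultimately show ?thesis by (simp add: filterlim_split_at)
qed

text \<open>
  Differentiation acts on the polynomial factor as \<open>q \<mapsto> X\<^sup>2 (q - q')\<close>. At \<open>0\<close> the difference quotient
  is again a flat function.
\<close>

lemma flat_DERIV: "(flat q has_real_derivative flat (pCons 0 (pCons 0 (q - pderiv q))) x) (at x)"
proof -
  consider "x > 0" | "x < 0" | "x = 0" by linarith
  then show ?thesis
  proof cases
    case 1
    have "((\<lambda>x. poly q (1 / x) * exp (- (1 / x))) has_real_derivative
        flat (pCons 0 (pCons 0 (q - pderiv q))) x) (at x)"
      using 1 by (auto intro!: derivative_eq_intros poly_DERIV[THEN DERIV_chain2]
          simp: flat_def field_simps power2_eq_square)
    then show ?thesis
      by (rule has_field_derivative_transform_within_open[of _ _ _ "{0<..}"]) (use 1 in \<open>auto simp: flat_def\<close>)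
  next
    case 2
    have "((\<lambda>x. 0) has_real_derivative flat (pCons 0 (pCons 0 (q - pderiv q))) x) (at x)"
      using 2 by (simp add: flat_def)
    then show ?thesis
      by (rule has_field_derivative_transform_within_open[of _ _ _ "{..<0}"]) (use 2 in \<open>auto simp: flat_def\<close>)
  next
    case 3
    have "(\<lambda>h. (flat q (0 + h) - flat q 0) / h) = flat (pCons 0 q)"
      by (auto simp: flat_def fun_eq_iff field_simps)
    then have "(flat q has_real_derivative 0) (at 0)"
      unfolding DERIV_def using flat_tendsto_0[of "pCons 0 q"] by simp
    then show ?thesis using 3 by (simp add: flat_def)
  qed
qed

text \<open>
  The algebra generated by the building blocks of the initial data. It is closed under
  differentiation, which gives derivatives of all orders by iteration.
\<close>

inductive_set smooth_alg :: "(real \<Rightarrow> real) set" where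
  flat: "(\<lambda>x. flat q (c + s * x)) \<in> smooth_alg"
| exp: "(\<lambda>x. exp (c + s * x)) \<in> smooth_alg"
| const: "(\<lambda>x. c) \<in> smooth_alg"
| add: "f \<in> smooth_alg \<Longrightarrow> g \<in> smooth_alg \<Longrightarrow> (\<lambda>x. f x + g x) \<in> smooth_alg"
| mult: "f \<in> smooth_alg \<Longrightarrow> g \<in> smooth_alg \<Longrightarrow> (\<lambda>x. f x * g x) \<in> smooth_alg"

lemma smooth_alg_deriv:
  assumes "f \<in> smooth_alg"
  shows "\<exists>f'\<in>smooth_alg. \<forall>x. (f has_real_derivative f' x) (at x)"
  using assms
proof induction
  case (flat q c s)
  have "((\<lambda>x. flat q (c + s * x)) has_real_derivative
      flat (pCons 0 (pCons 0 (q - pderiv q))) (c + s * x) * s) (at x)" for x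
    by (rule DERIV_chain2[OF flat_DERIV]) (auto intro!: derivative_eq_intros)
  then show ?case by (intro bexI[of _ "\<lambda>x. flat (pCons 0 (pCons 0 (q - pderiv q))) (c + s * x) * s"])
      (auto intro: smooth_alg.intros)
next
  case (exp c s)
  have "((\<lambda>x. exp (c + s * x)) has_real_derivative exp (c + s * x) * s) (at x)" for x
    by (auto intro!: derivative_eq_intros)
  then show ?case by (intro bexI[of _ "\<lambda>x. exp (c + s * x) * s"]) (auto intro: smooth_alg.intros)
next
  case (const c)
  then show ?case by (intro bexI[of _ "\<lambda>x. 0"]) (auto intro: smooth_alg.intros)
next
  case (add f g)
  then obtain f' g' where "f' \<in> smooth_alg" "g' \<in> smooth_alg"
    "\<And>x. (f has_real_derivative f' x) (at x)" "\<And>x. (g has_real_derivative g' x) (at x)" by blast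
  then show ?case by (intro bexI[of _ "\<lambda>x. f' x + g' x"]) (auto intro: smooth_alg.intros derivative_intros)
next
  case (mult f g)
  then obtain f' g' where "f' \<in> smooth_alg" "g' \<in> smooth_alg"
    "\<And>x. (f has_real_derivative f' x) (at x)" "\<And>x. (g has_real_derivative g' x) (at x)" by blast
  with mult.hyps show ?case
    by (intro bexI[of _ "\<lambda>x. f' x * g x + g' x * f x"]) (auto intro: smooth_alg.intros DERIV_mult)
qed

lemma smooth_alg_imp_C0_inf:
  assumes f: "f \<in> smooth_alg" and supp: "\<And>x. x < 1/4 \<or> x > 3/4 \<Longrightarrow> f x = 0"
  shows "C0_inf f"
proof -
  have "\<exists>D. \<forall>k. D k \<in> smooth_alg \<and> (k = 0 \<longrightarrow> D k = f) \<and> (\<forall>x. (D k has_real_derivative D (Suc k) x) (at x))"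
  proof (rule exE[OF dependent_nat_choice[where P = "\<lambda>k g. g \<in> smooth_alg \<and> (k = 0 \<longrightarrow> g = f)"
        and Q = "\<lambda>k g g'. \<forall>x. (g has_real_derivative g' x) (at x)"]])
    show "\<exists>g. g \<in> smooth_alg \<and> ((0::nat) = 0 \<longrightarrow> g = f)" using f by blast
    show "\<exists>g'. (g' \<in> smooth_alg \<and> (Suc k = 0 \<longrightarrow> g' = f)) \<and> (\<forall>x. (g has_real_derivative g' x) (at x))"
      if "g \<in> smooth_alg \<and> (k = 0 \<longrightarrow> g = f)" for g k
      using smooth_alg_deriv[of g] that by auto
  qed blast
  then obtain D where D: "D 0 = f" "\<And>k x. (D k has_real_derivative D (Suc k) x) (at x)" by blast
  have "support_on {0..1} f \<subseteq> {1/4..3/4}"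
    using supp by (auto simp: support_on_def) (meson not_less)+
  then have "closure (support_on {0..1} f) \<subseteq> {1/4..3/4}" by (rule closure_minimal) simp
  then have "closure (support_on {0..1} f) \<subseteq> {0<..<1}" by auto
  moreover have "\<forall>x\<in>{0..1}. (D k has_real_derivative D (Suc k) x) (at x within {0..1})" for k
    using D(2) has_field_derivative_at_within by blast
  ultimately show ?thesis unfolding C0_inf_def using D(1) by blast
qed

definition bump :: "real \<Rightarrow> real" where
  "bump x = flat 1 (- 1/4 + 1 * x) * flat 1 (3/4 + (- 1) * x)"

lemma bump_smooth: "bump \<in> smooth_alg"
  unfolding bump_def[abs_def] by (intro smooth_alg.intros)

lemma bump_support: "x < 1/4 \<or> x > 3/4 \<Longrightarrow> bump x = 0"
  by (auto simp: bump_def flat_def)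

lemma bump_symmetric: "bump (1 - x) = bump x"
  by (simp add: bump_def mult.commute algebra_simps)

lemma bump_half: "bump (1/2) \<noteq> 0"
  by (simp add: bump_def flat_def)

text \<open>
  One copy of \<open>F\<close> in each unit interval, scaled by \<open>c\<close>. The index is shifted by one, because the
  train starts at time \<open>-1\<close>: the pulse of \<open>[-1, 0)\<close> is what the initial data contain.
\<close>

definition pulse_train :: "(real \<Rightarrow> real) \<Rightarrow> (nat \<Rightarrow> real) \<Rightarrow> real \<Rightarrow> real" where
  "pulse_train F c \<tau> = c (nat (\<lfloor>\<tau>\<rfloor> + 1)) * F (\<tau> - \<lfloor>\<tau>\<rfloor>)"

text \<open>
  Near every point a single translate of \<open>F\<close> describes the train, since \<open>F\<close> vanishes close to
  both ends of its interval. This removes the discontinuity of the floor function.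
\<close>

lemma pulse_train_local:
  assumes supp: "\<And>x. x < 1/4 \<or> x > 3/4 \<Longrightarrow> F x = 0"
    and k: "of_int k - 1/4 < \<tau>" "\<tau> < of_int k + 5/4"
  shows "pulse_train F c \<tau> = c (nat (k + 1)) * F (\<tau> - of_int k)"
proof -
  consider "\<lfloor>\<tau>\<rfloor> = k" | "\<lfloor>\<tau>\<rfloor> = k - 1" | "\<lfloor>\<tau>\<rfloor> = k + 1"
    using k by linarith
  then show ?thesis
  proof cases
    case 1 then show ?thesis by (simp add: pulse_train_def)
  next
    case 2
    then have "\<tau> < of_int k" by linarith
    then have "F (\<tau> - of_int k) = 0" by (intro supp) linarith
    moreover have "F (\<tau> - \<lfloor>\<tau>\<rfloor>) = 0" using 2 k by (intro supp) auto
    ultimately show ?thesis by (simp add: pulse_train_def)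
  next
    case 3
    then have "\<tau> \<ge> of_int k + 1" by linarith
    then have "F (\<tau> - of_int k) = 0" by (intro supp) linarith
    moreover have "F (\<tau> - \<lfloor>\<tau>\<rfloor>) = 0" using 3 k by (intro supp) auto
    ultimately show ?thesis by (simp add: pulse_train_def)
  qed
qed

lemma pulse_train_DERIV:
  assumes supp: "\<And>x. x < 1/4 \<or> x > 3/4 \<Longrightarrow> F x = 0"
    and F: "\<And>x. (F has_real_derivative F' x) (at x)"
  shows "(pulse_train F c has_real_derivative pulse_train F' c \<tau>) (at \<tau>)"
proof -
  let ?k = "\<lfloor>\<tau>\<rfloor>"
  have "((\<lambda>\<sigma>. c (nat (?k + 1)) * F (\<sigma> - of_int ?k)) has_real_derivative
      c (nat (?k + 1)) * (F' (\<tau> - of_int ?k) * 1)) (at \<tau>)"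
    by (intro DERIV_cmult DERIV_chain2[OF F]) (auto intro!: derivative_eq_intros)
  then have "(pulse_train F c has_real_derivative c (nat (?k + 1)) * (F' (\<tau> - of_int ?k) * 1)) (at \<tau>)"
  proof (rule has_field_derivative_transform_within_open)
    show "open {of_int ?k - 1/4<..<of_int ?k + (5/4::real)}" by simp
    show "\<tau> \<in> {of_int ?k - 1/4<..<of_int ?k + (5/4::real)}"
      unfolding greaterThanLessThan_iff by linarith
  qed (use pulse_train_local[OF supp] in auto)
  then show ?thesis by (simp add: pulse_train_def)
qed

lemma deriv_support:
  fixes F F' :: "real \<Rightarrow> real"
  assumes supp: "\<And>x. x < 1/4 \<or> x > 3/4 \<Longrightarrow> F x = 0"
    and F: "\<And>x. (F has_real_derivative F' x) (at x)" and x: "x < 1/4 \<or> x > 3/4"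
  shows "F' x = 0"
proof -
  have "((\<lambda>x. 0) has_real_derivative F' x) (at x)"
    by (rule has_field_derivative_transform_within_open[OF F, of "{..<1/4} \<union> {3/4<..}"])
      (use x supp in \<open>auto intro!: open_Un\<close>)
  then show ?thesis using DERIV_const DERIV_unique by blast
qed

section \<open>Amplitudes that never die along a cycle\<close>

text \<open>
  Powers of the matrix with entries \<open>p i k * d k\<close>, applied to the vector \<open>w\<close>.
\<close>

primrec amplitude :: "nat \<Rightarrow> (nat \<Rightarrow> nat \<Rightarrow> real) \<Rightarrow> (nat \<Rightarrow> real) \<Rightarrow> (nat \<Rightarrow> real) \<Rightarrow> nat \<Rightarrow> nat \<Rightarrow> real" where
  "amplitude n p d w 0 = w"
| "amplitude n p d w (Suc l) = (\<lambda>i. \<Sum>k=1..n. p i k * d k * amplitude n p d w l k)"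

text \<open>
  Put \<open>d = 1\<close> on \<open>S\<close> and \<open>d = \<epsilon>\<close> off \<open>S\<close>. Consider the cone of vectors in which the
  modulus \<open>X\<close> of the largest entry on \<open>S\<close> is nonzero and all entries are at most \<open>\<kappa> * X\<close>. By the
  hypothesis, the largest entry on \<open>S\<close> is passed on to some entry in \<open>S\<close> without interference from
  the rest of \<open>S\<close>, and there has modulus at least \<open>c * X\<close>. The entries outside \<open>S\<close> interfere by at
  most \<open>\<epsilon> * B * \<kappa> * X\<close>, which the choice of \<open>\<epsilon>\<close> makes at most \<open>c / 2 * X\<close>. So \<open>X\<close> becomes at
  least \<open>c / 2 * X\<close>, while all entries of the image are at most \<open>(B + c / 2) * X = \<kappa> * (c / 2 * X)\<close>,
  and the image lies in the cone again.
\<close>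

lemma persistent_amplitude:
  fixes p :: "nat \<Rightarrow> nat \<Rightarrow> real"
  assumes "S \<subseteq> {1..n}" "S \<noteq> {}"
    and chordless: "\<And>j. j \<in> S \<Longrightarrow> \<exists>i\<in>S. p i j \<noteq> 0 \<and> (\<forall>k\<in>S. k \<noteq> j \<longrightarrow> p i k = 0)"
  shows "\<exists>d w. (\<forall>k. d k > 0) \<and> (\<forall>l. \<exists>j\<in>{1..n}. amplitude n p d w l j \<noteq> 0)"
proof -
  have fin: "finite S" using assms(1) finite_subset by blast
  obtain s where s: "\<And>j. j \<in> S \<Longrightarrow> s j \<in> S \<and> p (s j) j \<noteq> 0 \<and> (\<forall>k\<in>S. k \<noteq> j \<longrightarrow> p (s j) k = 0)"
    using chordless by metis
  define c where "c = Min ((\<lambda>j. \<bar>p (s j) j\<bar>) ` S)"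
  have c_le: "c \<le> \<bar>p (s j) j\<bar>" if "j \<in> S" for j
    unfolding c_def using fin that by (intro Min_le) auto
  have c0: "c > 0"
    unfolding c_def using fin \<open>S \<noteq> {}\<close> s by (subst Min_gr_iff) auto
  define B where "B = (\<Sum>i=1..n. \<Sum>k=1..n. \<bar>p i k\<bar>)"
  have B0: "B \<ge> 0" unfolding B_def by (intro sum_nonneg) auto
  have row: "(\<Sum>k=1..n. \<bar>p i k\<bar>) \<le> B" if "i \<in> {1..n}" for i
    unfolding B_def using that by (intro member_le_sum[of i "{1..n}" "\<lambda>i. \<Sum>k=1..n. \<bar>p i k\<bar>"]) (auto intro: sum_nonneg)
  \<comment> \<open>\<open>\<kappa>\<close> solves \<open>B + c / 2 = \<kappa> * (c / 2)\<close>, and \<open>\<epsilon>\<close> is small enough for \<open>\<epsilon> * B * \<kappa> \<le> c / 2\<close>\<close>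
  define \<kappa> where "\<kappa> = 2 * B / c + 1"
  have \<kappa>1: "\<kappa> \<ge> 1" using B0 c0 by (simp add: \<kappa>_def)
  have \<kappa>c: "B + c / 2 = \<kappa> * (c / 2)" using c0 by (simp add: \<kappa>_def field_simps)
  define \<epsilon> where "\<epsilon> = c / (2 * (B * \<kappa> + 1))"
  have den: "B * \<kappa> + 1 > 0" using B0 \<kappa>1 by (simp add: add_nonneg_pos)
  have \<epsilon>0: "\<epsilon> > 0" using c0 den by (simp add: \<epsilon>_def)
  have "\<epsilon> * (B * \<kappa>) \<le> \<epsilon> * (B * \<kappa> + 1)" using \<epsilon>0 by simp
  also have "\<dots> = c / 2" using den unfolding \<epsilon>_def
    by (metis divide_divide_eq_left mult.commute nonzero_eq_divide_eq order_less_irrefl)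
  finally have \<epsilon>c: "\<epsilon> * (B * \<kappa>) \<le> c / 2" .
  define d where "d k = (if k \<in> S then 1 else \<epsilon>)" for k
  define w where "w k = (if k \<in> S then 1 else 0 :: real)" for k :: nat
  define cone where "cone x j \<longleftrightarrow> j \<in> S \<and> x j \<noteq> 0 \<and> (\<forall>i\<in>S. \<bar>x i\<bar> \<le> \<bar>x j\<bar>) \<and>
    (\<forall>i\<in>{1..n}. \<bar>x i\<bar> \<le> \<kappa> * \<bar>x j\<bar>)" for x :: "nat \<Rightarrow> real" and j
  have "\<exists>j. cone (amplitude n p d w l) j" for l
  proof (induction l)
    case 0
    obtain j where "j \<in> S" using \<open>S \<noteq> {}\<close> by blast
    then have "cone w j" unfolding cone_def w_def using \<kappa>1 by auto
    then show ?case by auto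
  next
    case (Suc l)
    let ?x = "amplitude n p d w l" and ?y = "amplitude n p d w (Suc l)"
    obtain j where j: "j \<in> S" "?x j \<noteq> 0" "\<And>i. i \<in> S \<Longrightarrow> \<bar>?x i\<bar> \<le> \<bar>?x j\<bar>"
      "\<And>i. i \<in> {1..n} \<Longrightarrow> \<bar>?x i\<bar> \<le> \<kappa> * \<bar>?x j\<bar>"
      using Suc unfolding cone_def by blast
    define X where "X = \<bar>?x j\<bar>"
    have X0: "X > 0" using j by (simp add: X_def)
    define y1 where "y1 i = (\<Sum>k\<in>S. p i k * ?x k)" for i
    define y2 where "y2 i = (\<Sum>k\<in>{1..n}-S. p i k * (\<epsilon> * ?x k))" for i
    have y: "?y i = y1 i + y2 i" for i
    proof -
      have "?y i = (\<Sum>k\<in>{1..n}-S. p i k * d k * ?x k) + (\<Sum>k\<in>S. p i k * d k * ?x k)"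
        using sum.subset_diff[OF assms(1), of "\<lambda>k. p i k * d k * ?x k"] by simp
      also have "(\<Sum>k\<in>{1..n}-S. p i k * d k * ?x k) = y2 i"
        unfolding y2_def by (rule sum.cong) (auto simp: d_def)
      also have "(\<Sum>k\<in>S. p i k * d k * ?x k) = y1 i"
        unfolding y1_def by (rule sum.cong) (auto simp: d_def)
      finally show ?thesis by simp
    qed
    have y1: "\<bar>y1 i\<bar> \<le> B * X" if "i \<in> {1..n}" for i
    proof -
      have "\<bar>y1 i\<bar> \<le> (\<Sum>k\<in>S. \<bar>p i k\<bar> * X)"
        unfolding y1_def using j(3) by (intro order_trans[OF sum_abs] sum_mono) (auto simp: abs_mult X_def intro: mult_left_mono)
      also have "\<dots> \<le> (\<Sum>k=1..n. \<bar>p i k\<bar> * X)"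
        using assms(1) X0 by (intro sum_mono2) auto
      also have "\<dots> \<le> B * X"
        unfolding sum_distrib_right[symmetric] using row[OF that] X0 by (intro mult_right_mono) auto
      finally show ?thesis .
    qed
    have y2: "\<bar>y2 i\<bar> \<le> c / 2 * X" if "i \<in> {1..n}" for i
    proof -
      have "\<bar>y2 i\<bar> \<le> (\<Sum>k\<in>{1..n}-S. \<bar>p i k\<bar> * (\<epsilon> * (\<kappa> * X)))"
        unfolding y2_def using j(4) \<epsilon>0
        by (intro order_trans[OF sum_abs] sum_mono) (auto simp: abs_mult X_def intro!: mult_left_mono)
      also have "\<dots> \<le> (\<Sum>k=1..n. \<bar>p i k\<bar> * (\<epsilon> * (\<kappa> * X)))"
        using X0 \<epsilon>0 \<kappa>1 by (intro sum_mono2) auto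
      also have "\<dots> \<le> B * (\<epsilon> * (\<kappa> * X))"
        unfolding sum_distrib_right[symmetric] using row[OF that] X0 \<epsilon>0 \<kappa>1 by (intro mult_right_mono) auto
      also have "\<dots> = \<epsilon> * (B * \<kappa>) * X" by simp
      also have "\<dots> \<le> c / 2 * X" using \<epsilon>c X0 by (intro mult_right_mono) auto
      finally show ?thesis .
    qed
    have up: "\<bar>?y i\<bar> \<le> \<kappa> * (c / 2 * X)" if "i \<in> {1..n}" for i
    proof -
      have "\<bar>?y i\<bar> \<le> (B + c / 2) * X"
        unfolding y using y1[OF that] y2[OF that] abs_triangle_ineq[of "y1 i" "y2 i"]
        by (simp add: algebra_simps)
      then show ?thesis unfolding \<kappa>c by simp
    qed
    have low: "c / 2 * X \<le> \<bar>?y (s j)\<bar>"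
    proof -
      have sj: "s j \<in> S" using s[OF j(1)] by blast
      have "y1 (s j) = (\<Sum>k\<in>S. if k = j then p (s j) j * ?x j else 0)"
        unfolding y1_def by (rule sum.cong) (use s[OF j(1)] in auto)
      also have "\<dots> = p (s j) j * ?x j" using fin j(1) by simp
      finally have "\<bar>y1 (s j)\<bar> \<ge> c * X"
        using c_le[OF j(1)] by (simp add: abs_mult X_def mult_right_mono)
      moreover have "\<bar>y2 (s j)\<bar> \<le> c / 2 * X" using y2 sj assms(1) by blast
      moreover have "c / 2 * X = c * X / 2" by simp
      ultimately show ?thesis unfolding y by linarith
    qed
    obtain i where i: "i \<in> S" "\<And>k. k \<in> S \<Longrightarrow> \<bar>?y k\<bar> \<le> \<bar>?y i\<bar>"
    proof -
      have "Max ((\<lambda>k. \<bar>?y k\<bar>) ` S) \<in> (\<lambda>k. \<bar>?y k\<bar>) ` S"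
        using fin \<open>S \<noteq> {}\<close> by (intro Max_in) auto
      then obtain i where "i \<in> S" "\<bar>?y i\<bar> = Max ((\<lambda>k. \<bar>?y k\<bar>) ` S)" by auto
      moreover have "\<bar>?y k\<bar> \<le> Max ((\<lambda>k. \<bar>?y k\<bar>) ` S)" if "k \<in> S" for k
        using fin that by (intro Max_ge) auto
      ultimately show ?thesis using that by metis
    qed
    have big: "c / 2 * X \<le> \<bar>?y i\<bar>" using low i(2)[of "s j"] s[OF j(1)] by linarith
    have "?y i \<noteq> 0" using big c0 X0 mult_pos_pos[of "c/2" X] by linarith
    moreover have "\<bar>?y k\<bar> \<le> \<kappa> * \<bar>?y i\<bar>" if "k \<in> {1..n}" for k
      by (rule order_trans[OF up[OF that] mult_left_mono[OF big]]) (use \<kappa>1 in simp)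
    ultimately have "cone ?y i" unfolding cone_def using i by blast
    then show ?case by blast
  qed
  then have "\<exists>j\<in>{1..n}. amplitude n p d w l j \<noteq> 0" for l
    using assms(1) unfolding cone_def by blast
  moreover have "d k > 0" for k using \<epsilon>0 by (simp add: d_def)
  ultimately show ?thesis by blast
qed

section \<open>An explicit immortal solution\<close>

text \<open>
  The distance from the inflow end, which at unit speed is also the time elapsed since inflow.
\<close>

definition depth :: "nat \<Rightarrow> nat \<Rightarrow> real \<Rightarrow> real" where
  "depth m j x = (if j \<le> m then x else 1 - x)"

text \<open>
  A train of bumps moving at unit speed and multiplied by \<open>d j\<close> in total while crossing the
  interval.
\<close>

definition pulse_solution :: "nat \<Rightarrow> (nat \<Rightarrow> real) \<Rightarrow> (nat \<Rightarrow> nat \<Rightarrow> real) \<Rightarrow> nat \<Rightarrow> real \<times> real \<Rightarrow> real" where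
  "pulse_solution m d W j = (\<lambda>(x, t). exp (ln (d j) * depth m j x) * pulse_train bump (\<lambda>l. W l j) (t - depth m j x))"

lemma depth_DERIV: "(depth m j has_real_derivative (if j \<le> m then 1 else -1)) (at x within A)"
  unfolding depth_def[abs_def] by (auto intro!: derivative_eq_intros)

text \<open>
  The profile and its derivative vanish near the ends of their interval, so the train is continuously
  differentiable in spite of the jumping amplitudes. The identity between the partial derivatives is the
  transport equation with speed \<open>1\<close> or \<open>-1\<close> and \<open>b j = - ln (d j)\<close>.
\<close>

lemma pulse_solution_C1:
  "\<exists>ux ut. C1_with_partials (pulse_solution m d W j) ux ut \<and>
    (\<forall>z. ut z + (if j \<le> m then 1 else -1) * ux z = ln (d j) * pulse_solution m d W j z)"
proof -
  obtain F' where F': "F' \<in> smooth_alg" "\<And>x. (bump has_real_derivative F' x) (at x)"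
    using smooth_alg_deriv[OF bump_smooth] by blast
  obtain F'' where F'': "\<And>x. (F' has_real_derivative F'' x) (at x)"
    using smooth_alg_deriv[OF F'(1)] by blast
  have F'0: "F' x = 0" if "x < 1/4 \<or> x > 3/4" for x
    using deriv_support[OF bump_support F'(2) that] .
  define V where "V = pulse_train bump (\<lambda>l. W l j)"
  define V' where "V' = pulse_train F' (\<lambda>l. W l j)"
  have V: "(V has_real_derivative V' \<tau>) (at \<tau>)" for \<tau>
    unfolding V_def V'_def by (rule pulse_train_DERIV[OF bump_support F'(2)])
  have V': "(V' has_real_derivative pulse_train F'' (\<lambda>l. W l j) \<tau>) (at \<tau>)" for \<tau>
    unfolding V'_def by (rule pulse_train_DERIV[OF F'0 F''])
  have contV: "continuous_on UNIV V" "continuous_on UNIV V'"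
    using V V' by (auto intro!: continuous_at_imp_continuous_on DERIV_isCont)
  define \<sigma> where "\<sigma> = (if j \<le> m then 1 else -1 :: real)"
  let ?y = "\<lambda>z. depth m j (fst z)"
  let ?G = "\<lambda>z. exp (ln (d j) * ?y z)"
  let ?ux = "\<lambda>z. ?G z * (ln (d j) * \<sigma> * V (snd z - ?y z) - \<sigma> * V' (snd z - ?y z))"
  let ?ut = "\<lambda>z. ?G z * V' (snd z - ?y z)"
  have conty: "continuous_on A ?y" for A
    unfolding depth_def by (cases "j \<le> m") (auto intro!: continuous_intros)
  have contF: "continuous_on A (\<lambda>z. f (snd z - ?y z))" if "continuous_on UNIV f" for f :: "real \<Rightarrow> real" and A
    by (rule continuous_on_compose2[OF that]) (auto intro!: continuous_intros conty)
  have "C1_with_partials (pulse_solution m d W j) ?ux ?ut"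
    unfolding C1_with_partials_def
  proof (intro conjI ballI)
    show "continuous_on Pi_strip ?ux" "continuous_on Pi_strip ?ut"
      by (intro continuous_intros conty contF contV)+
    fix z :: "real \<times> real" assume "z \<in> Pi_strip"
    have y: "(?y has_derivative (\<lambda>h. fst h * \<sigma>)) (at z within Pi_strip)"
      unfolding \<sigma>_def by (rule DERIV_compose_FDERIV[OF depth_DERIV]) (auto intro!: derivative_eq_intros)
    have arg: "((\<lambda>z. snd z - ?y z) has_derivative (\<lambda>h. snd h - fst h * \<sigma>)) (at z within Pi_strip)"
      by (intro has_derivative_diff y has_derivative_snd has_derivative_ident)
    have "((\<lambda>z. V (snd z - ?y z)) has_derivative (\<lambda>h. (snd h - fst h * \<sigma>) * V' (snd z - ?y z))) (at z within Pi_strip)"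
      by (rule DERIV_compose_FDERIV[OF V arg])
    moreover have "(?G has_derivative (\<lambda>h. ln (d j) * (fst h * \<sigma>) * ?G z)) (at z within Pi_strip)"
      by (rule DERIV_compose_FDERIV[OF DERIV_exp]) (intro has_derivative_mult_right y)
    ultimately have "((\<lambda>z. ?G z * V (snd z - ?y z)) has_derivative
       (\<lambda>h. ?G z * ((snd h - fst h * \<sigma>) * V' (snd z - ?y z)) + ln (d j) * (fst h * \<sigma>) * ?G z * V (snd z - ?y z)))
       (at z within Pi_strip)"
      by (intro has_derivative_mult)
    moreover have "(\<lambda>h. ?G z * ((snd h - fst h * \<sigma>) * V' (snd z - ?y z)) + ln (d j) * (fst h * \<sigma>) * ?G z * V (snd z - ?y z))
        = (\<lambda>(h, k). ?ux z * h + ?ut z * k)"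
      by (auto simp: fun_eq_iff algebra_simps)
    moreover have "pulse_solution m d W j = (\<lambda>z. ?G z * V (snd z - ?y z))"
      by (auto simp: pulse_solution_def V_def)
    ultimately show "(pulse_solution m d W j has_derivative (\<lambda>(h, k). ?ux z * h + ?ut z * k)) (at z within Pi_strip)"
      by simp
  qed
  moreover have "?ut z + (if j \<le> m then 1 else -1) * ?ux z = ln (d j) * pulse_solution m d W j z" for z
    by (cases z) (auto simp: pulse_solution_def \<sigma>_def V_def algebra_simps)
  ultimately show ?thesis by blast
qed

lemma pulse_solution_inflow:
  "t \<ge> 0 \<Longrightarrow> depth m j x = 0 \<Longrightarrow> pulse_solution m d W j (x, t) = W (Suc (nat \<lfloor>t\<rfloor>)) j * bump (t - \<lfloor>t\<rfloor>)"
  by (simp add: pulse_solution_def pulse_train_def nat_add_distrib)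

lemma pulse_solution_outflow:
  assumes "t \<ge> 0" "depth m j x = 1" "d j > 0"
  shows "pulse_solution m d W j (x, t) = d j * W (nat \<lfloor>t\<rfloor>) j * bump (t - \<lfloor>t\<rfloor>)"
proof -
  have "\<lfloor>t - 1\<rfloor> = \<lfloor>t\<rfloor> - 1" by linarith
  then show ?thesis using assms by (simp add: pulse_solution_def pulse_train_def)
qed

definition pulse_data :: "nat \<Rightarrow> (nat \<Rightarrow> real) \<Rightarrow> (nat \<Rightarrow> real) \<Rightarrow> nat \<Rightarrow> real \<Rightarrow> real" where
  "pulse_data m d w j x = exp (ln (d j) * depth m j x) * (w j * bump x)"

lemma pulse_data_C0_inf: "C0_inf (pulse_data m d w j)"
proof (rule smooth_alg_imp_C0_inf)
  have e: "(\<lambda>x. exp (ln (d j) * depth m j x)) \<in> smooth_alg"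
  proof (cases "j \<le> m")
    case True
    then show ?thesis using smooth_alg.exp[of 0 "ln (d j)"] by (simp add: depth_def)
  next
    case False
    then show ?thesis using smooth_alg.exp[of "ln (d j)" "- ln (d j)"] by (simp add: depth_def algebra_simps)
  qed
  then show "pulse_data m d w j \<in> smooth_alg"
    unfolding pulse_data_def[abs_def] by (intro smooth_alg.mult smooth_alg.const bump_smooth e)
qed (simp add: pulse_data_def bump_support)

lemma pulse_solution_initial:
  assumes "x \<in> {0..1}"
  shows "pulse_solution m d W j (x, 0) = pulse_data m d (W 0) j x"
proof -
  let ?y = "depth m j x"
  have y: "0 \<le> ?y" "?y \<le> 1" using assms by (auto simp: depth_def)
  have "bump ?y = bump x" by (simp add: depth_def bump_symmetric)
  moreover have "pulse_train bump (\<lambda>l. W l j) (- ?y) = W 0 j * bump ?y"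
  proof (cases "?y = 0")
    case True
    then show ?thesis by (simp add: pulse_train_def bump_support)
  next
    case False
    then have "\<lfloor>- ?y\<rfloor> = -1" using y by linarith
    then show ?thesis using bump_symmetric[of ?y] by (simp add: pulse_train_def)
  qed
  ultimately show ?thesis by (simp add: pulse_solution_def pulse_data_def)
qed

definition unit_speed :: "nat \<Rightarrow> nat \<Rightarrow> real \<times> real \<Rightarrow> real" where
  "unit_speed m j z = (if j \<le> m then 1 else -1)"

lemma bounded_C1_Pi_const: "bounded_C1_Pi (\<lambda>z. c)"
proof -
  have "(\<lambda>(h, k). 0) = (\<lambda>z::real \<times> real. 0::real)" by auto
  then have "C1_with_partials (\<lambda>z. c) (\<lambda>z. 0) (\<lambda>z. 0)"
    unfolding C1_with_partials_def by simp
  then show ?thesis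
    unfolding bounded_C1_Pi_def by (intro exI[of _ "\<lambda>z. 0"]) (auto simp: bounded_iff)
qed

lemma admissible_unit_speed: "admissible n m (unit_speed m) (\<lambda>j z. c j)"
  unfolding admissible_def unit_speed_def[abs_def]
  by (intro conjI exI[of _ 1] ballI bounded_C1_Pi_const) auto

text \<open>
  All components carry the same bump profile at the same phase, so the boundary condition reduces to
  the recursion that defines the amplitudes.
\<close>

lemma pulse_solution_classical:
  fixes p :: "nat \<Rightarrow> nat \<Rightarrow> real" and d w :: "nat \<Rightarrow> real"
  assumes d: "\<And>k. d k > 0" and "m \<le> n"
  defines "W \<equiv> amplitude n p d w"
  shows "classical_solution n m p (unit_speed m) (\<lambda>j z. - ln (d j)) (pulse_data m d w) (pulse_solution m d W)"
proof -
  let ?u = "pulse_solution m d W"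
  have bv: "boundary_value n m p ?u j t = W (Suc (nat \<lfloor>t\<rfloor>)) j * bump (t - \<lfloor>t\<rfloor>)" if t: "t \<ge> 0" for j t
  proof -
    let ?g = "\<lambda>k. p j k * d k * W (nat \<lfloor>t\<rfloor>) k * bump (t - \<lfloor>t\<rfloor>)"
    have "boundary_value n m p ?u j t = (\<Sum>k=1..m. ?g k) + (\<Sum>k=m+1..n. ?g k)"
      unfolding boundary_value_def
      by (intro arg_cong2[where f = "(+)"] sum.cong refl)
        (auto simp: depth_def pulse_solution_outflow[OF t _ d])
    also have "\<dots> = (\<Sum>k=1..n. ?g k)"
    proof -
      have "{1..n} = {1..m} \<union> {m+1..n}" using \<open>m \<le> n\<close> by auto
      then show ?thesis by (simp only:) (rule sum.union_disjoint[symmetric], auto)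
    qed
    finally show ?thesis by (simp add: W_def sum_distrib_right)
  qed
  show ?thesis
    unfolding classical_solution_def
  proof (intro conjI ballI allI impI)
    fix j assume "j \<in> {1..n}"
    show "C1_Pi (?u j)" unfolding C1_Pi_def using pulse_solution_C1[of m d W j] by blast
    fix x t :: real
    assume xt: "0 < x \<and> x < 1 \<and> 0 < t"
    obtain ux ut where u: "C1_with_partials (?u j) ux ut"
      "\<And>z. ut z + (if j \<le> m then 1 else -1) * ux z = ln (d j) * ?u j z"
      using pulse_solution_C1[of m d W j] by blast
    have "at x within {0..1} = at x" using xt by (intro at_within_interior) simp
    then have dx: "deriv (\<lambda>y. ?u j (y, t)) x = ux (x, t)"
      using C1_with_partials_DERIV_x[OF u(1), of x t] xt by (simp add: DERIV_imp_deriv)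
    have "at t within {0..} = at t" using xt by (intro at_within_interior) simp
    then have dt: "deriv (\<lambda>s. ?u j (x, s)) t = ut (x, t)"
      using C1_with_partials_DERIV_t[OF u(1), of x t] xt by (simp add: DERIV_imp_deriv)
    show "deriv (\<lambda>s. ?u j (x, s)) t + unit_speed m j (x, t) * deriv (\<lambda>y. ?u j (y, t)) x
        + - ln (d j) * ?u j (x, t) = 0"
      using u(2)[of "(x, t)"] unfolding dx dt unit_speed_def by linarith
  next
    fix j t assume "j \<in> {1..m}" "(0::real) \<le> t"
    then show "?u j (0, t) = boundary_value n m p ?u j t"
      by (subst bv, simp) (rule pulse_solution_inflow, auto simp: depth_def)
  next
    fix j t assume "j \<in> {m+1..n}" "(0::real) \<le> t"
    then show "?u j (1, t) = boundary_value n m p ?u j t"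
      by (subst bv, simp) (rule pulse_solution_inflow, auto simp: depth_def)
  next
    fix j and x :: real assume "x \<in> {0..1}"
    then show "?u j (x, 0) = pulse_data m d w j x"
      by (simp add: pulse_solution_initial W_def)
  qed
qed

text \<open>
  Test the generalized solution with the constant sequence of data.
\<close>

lemma generalized_solution_eq_classical:
  assumes n: "n \<ge> 1" and u: "L2_generalized_solution n m p a b \<phi> u"
    and \<phi>: "\<And>j. j \<in> {1..n} \<Longrightarrow> C0_inf (\<phi> j)" and v: "classical_solution n m p a b \<phi> v"
    and j: "j \<in> {1..n}" and t: "t > 0"
  shows "norm_L2 (\<lambda>x. u j t x - v j (x, t)) = 0"
proof -
  have "norm_L2n n (\<lambda>j x. \<phi> j x - \<phi> j x) = 0"
    using n by (simp add: norm_L2n_def norm_L2_def)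
  then have "uniform_limit {0..t} (\<lambda>l t. norm_L2n n (\<lambda>j x. u j t x - v j (x, t))) (\<lambda>t. 0) sequentially"
    using u \<phi> v t unfolding L2_generalized_solution_def
    by (elim conjE allE[of _ "\<lambda>l. \<phi>"] allE[of _ "\<lambda>l. v"]) simp
  then have "(\<lambda>l::nat. norm_L2n n (\<lambda>j x. u j t x - v j (x, t))) \<longlonglongrightarrow> 0"
    by (rule tendsto_uniform_limitI) (use t in simp)
  then have "norm_L2n n (\<lambda>j x. u j t x - v j (x, t)) = 0"
    by (simp add: LIMSEQ_const_iff)
  then have "norm_L2 (\<lambda>x. u j t x - v j (x, t)) \<le> 0"
    using norm_L2n_le_iff[OF n, of "\<lambda>j x. u j t x - v j (x, t)" 0] j by auto
  then show ?thesis using norm_L2_nonneg by (intro antisym)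
qed

lemma continuous_AE_zero:
  assumes f: "continuous_on {0..1} f" and ae: "AE x in lebesgue_on {0<..<1}. f x = 0"
    and x: "0 < x" "x < (1::real)"
  shows "f x = (0::real)"
proof -
  have "AE x in lebesgue_on {0<..<1}. (f x)\<^sup>2 = 0" using ae by eventually_elim simp
  then have "(norm_L2 f)\<^sup>2 = 0" unfolding norm_L2_power2 by (rule integral_eq_zero_AE)
  then have "integral {0..1} (\<lambda>x. (f x)\<^sup>2) = 0"
    using in_L2_continuous(2)[OF f] by simp
  then have "\<forall>x\<in>{0..1}. (f x)\<^sup>2 = 0"
    by (subst (asm) integral_eq_0_iff) (auto intro!: continuous_intros f)
  then show ?thesis using x by auto
qed

section \<open>The equivalence\<close>

text \<open>
  For any candidate time \<open>Te\<close>, evaluate the immortal solution at an integer time \<open>l\<close> beyond it and at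
  the midpoint: there the bump does not vanish, and some amplitude number \<open>l\<close> is nonzero.
\<close>

lemma cyclic_imp_not_robust_FTS:
  assumes n: "n \<ge> 1" and mn: "m \<le> n" and cyc: "\<not> acyclic_digraph {1..n} (G_arrows n p)"
  shows "\<not> robust_FTS n m p"
proof
  assume robust: "robust_FTS n m p"
  have "finite {1..n}" by simp
  from chordless_cycle_set[OF this cyc]
  obtain S where S': "S \<subseteq> {1..n} \<and> S \<noteq> {} \<and>
      (\<forall>j\<in>S. \<exists>i\<in>S. (i, j) \<in> G_arrows n p \<and> (\<forall>k\<in>S. k \<noteq> j \<longrightarrow> (i, k) \<notin> G_arrows n p))"
    by (rule exE)
  note S = conjunct1[OF S'] conjunct1[OF conjunct2[OF S']] conjunct2[OF conjunct2[OF S']]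
  have chordless: "\<exists>i\<in>S. p i j \<noteq> 0 \<and> (\<forall>k\<in>S. k \<noteq> j \<longrightarrow> p i k = 0)" if j: "j \<in> S" for j
  proof -
    obtain i where "i \<in> S" "(i, j) \<in> G_arrows n p" "\<forall>k\<in>S. k \<noteq> j \<longrightarrow> (i, k) \<notin> G_arrows n p"
      using S(3) j by meson
    moreover have "{i, j} \<union> S \<subseteq> {1..n}" using calculation(1) j S(1) by auto
    ultimately show ?thesis by (intro bexI[of _ i]) (auto simp: G_arrows_def subset_iff)
  qed
  obtain d w where d: "\<And>k. d k > 0" and amp: "\<And>l. \<exists>j\<in>{1..n}. amplitude n p d w l j \<noteq> 0"
    using persistent_amplitude[OF S(1,2) chordless] by blast
  define W where "W = amplitude n p d w"
  let ?b = "\<lambda>j z::real \<times> real. - ln (d j)" and ?\<phi> = "pulse_data m d w" and ?v = "pulse_solution m d W"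
  have v: "classical_solution n m p (unit_speed m) ?b ?\<phi> ?v"
    unfolding W_def by (rule pulse_solution_classical[OF d mn])
  have "FTS n m p (unit_speed m) ?b"
    using robust admissible_unit_speed[of n m "\<lambda>j. - ln (d j)"] unfolding robust_FTS_def by simp
  then obtain Te where Te: "Te > 0" and extinct: "\<forall>\<phi>. (\<forall>j\<in>{1..n}. in_L2 (\<phi> j)) \<longrightarrow>
      (\<exists>u. L2_generalized_solution n m p (unit_speed m) ?b \<phi> u \<and>
        (\<forall>t>Te. \<forall>j\<in>{1..n}. AE x in lebesgue_on {0<..<1}. u j t x = 0))"
    unfolding FTS_def by (elim exE conjE) (rule that)
  have cv: "continuous_on {0..1} (\<lambda>x. ?v j (x, t))" if "t \<ge> 0" for j t
  proof -
    obtain ux ut where "C1_with_partials (?v j) ux ut" using pulse_solution_C1[of m d W j] by blast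
    then show ?thesis by (rule continuous_on_strip_x[OF C1_with_partials_continuous(1) that])
  qed
  have "in_L2 (?\<phi> j)" for j
  proof -
    have "in_L2 (\<lambda>x. ?v j (x, 0))" by (rule in_L2_continuous(1)[OF cv]) simp
    then show ?thesis
      by (subst (asm) in_L2_cong[where g = "?\<phi> j"]) (auto simp: pulse_solution_initial W_def)
  qed
  then have "\<exists>u. L2_generalized_solution n m p (unit_speed m) ?b ?\<phi> u \<and>
        (\<forall>t>Te. \<forall>j\<in>{1..n}. AE x in lebesgue_on {0<..<1}. u j t x = 0)"
    by (intro extinct[rule_format])
  then obtain u where u: "L2_generalized_solution n m p (unit_speed m) ?b ?\<phi> u"
    "\<forall>t>Te. \<forall>j\<in>{1..n}. AE x in lebesgue_on {0<..<1}. u j t x = 0"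
    by (elim exE conjE) (rule that)
  define l where "l = nat \<lceil>Te\<rceil> + 1"
  have l: "real l > Te" unfolding l_def by linarith
  obtain j where j: "j \<in> {1..n}" "W l j \<noteq> 0" using amp[of l] unfolding W_def by blast
  have tpos: "real l > 0" using l Te by linarith
  have "norm_L2 (\<lambda>x. u j (real l) x - ?v j (x, real l)) = 0"
    by (rule generalized_solution_eq_classical[OF n u(1) pulse_data_C0_inf v j(1) tpos])
  moreover have "in_L2 (\<lambda>x. u j (real l) x - ?v j (x, real l))"
  proof (rule in_L2_diff(1))
    show "in_L2 (u j (real l))" using u(1) j(1) by (simp add: L2_generalized_solution_def)
    show "in_L2 (\<lambda>x. ?v j (x, real l))" by (rule in_L2_continuous(1)[OF cv]) simp
  qed
  ultimately have "AE x in lebesgue_on {0<..<1}. u j (real l) x - ?v j (x, real l) = 0"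
    by (intro norm_L2_eq_0_imp_AE)
  moreover have "AE x in lebesgue_on {0<..<1}. u j (real l) x = 0" using u(2) l j(1) by blast
  ultimately have "AE x in lebesgue_on {0<..<1}. ?v j (x, real l) = 0" by eventually_elim simp
  then have "?v j (1/2, real l) = 0"
    by (intro continuous_AE_zero[OF cv, of "real l" j "1/2"]) auto
  moreover have "?v j (1/2, real l) \<noteq> 0"
  proof -
    have y: "depth m j (1/2) = 1/2" by (simp add: depth_def)
    have "\<lfloor>real l - 1/2\<rfloor> = int l - 1" by linarith
    then show ?thesis using j(2) bump_half by (simp add: pulse_solution_def pulse_train_def y)
  qed
  ultimately show False by simp
qed

theorem theorem1p6:
  fixes n m :: nat and p :: "nat \<Rightarrow> nat \<Rightarrow> real"
  assumes "n \<ge> 2" and "m \<le> n"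
  shows "robust_FTS n m p \<longleftrightarrow> acyclic_digraph {1..n} (G_arrows n p)"
proof
  show "acyclic_digraph {1..n} (G_arrows n p)" if "robust_FTS n m p"
    using cyclic_imp_not_robust_FTS[of n m p] assms that by auto
  show "robust_FTS n m p" if "acyclic_digraph {1..n} (G_arrows n p)"
    unfolding robust_FTS_def using acyclic_imp_FTS[of n m _ _ p] assms that by auto
qed

end
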